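(* Let $1<p<\infty$. Then for each $\alpha$ with $0<\alpha<\frac{p}{2p-1}$ there is a Hölder $\alpha$ graph $\Gamma\subset\mathbb{R}^2$ which is not $W^{1,p}$-removable for continuous functions in $\mathbb{R}^2$. In particular, for $p=2$, for each $0<\alpha<2/3$ there is a Hölder $\alpha$ graph which is not $W^{1,2}$-removable for continuous functions in $\mathbb{R}^2$.
   Context: A Hölder $\alpha$ graph is the graph $\{(x,f(x)):x\in[0,1]\}\subset\mathbb{R}^2$ of a function $f:[0,1]\to\mathbb{R}$ satisfying $|f(x)-f(y)|\le C|x-y|^\alpha$ for all $x,y\in[0,1]$, for some constant $C$. For an open set $\Omega\subset\mathbb{R}^2$, $W^{1,p}(\Omega)$ is the set of functions $u\in L^p(\Omega)$ for which there are functions $\partial_j u\in L^p(\Omega)$, $j=1,2$, with $\int_\Omega u\,\partial_j\psi\,dx=-\int_\Omega \psi\,\partial_j u\,dx$ for all $\psi\in C_0^\infty(\Omega)$ and $j=1,2$. A compact set $K\subset\mathbb{R}^2$ is called $W^{1,p}$-removable for continuous functions in $\mathbb{R}^2$ if every function that is continuous in $\mathbb{R}^2$ and belongs to $W^{1,p}(\mathbb{R}^2\setminus K)$ belongs to $W^{1,p}(\mathbb{R}^2)$. *)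

theory Defs
  imports "HOL-Analysis.Analysis"
begin

definition holder_graph :: "real \<Rightarrow> (real \<times> real) set \<Rightarrow> bool" where
  "holder_graph \<alpha> \<Gamma> \<longleftrightarrow>
     (\<exists>(f :: real \<Rightarrow> real) C.
        (\<forall>x\<in>{0..1}. \<forall>y\<in>{0..1}. \<bar>f x - f y\<bar> \<le> C * \<bar>x - y\<bar> powr \<alpha>) \<and>
        \<Gamma> = {(x, f x) | x. x \<in> {0..1}})"

definition partial_deriv :: "'a::euclidean_space \<Rightarrow> ('a \<Rightarrow> real) \<Rightarrow> 'a \<Rightarrow> real" where
  "partial_deriv b f x = frechet_derivative f (at x) b"

fun times_cont_diff :: "nat \<Rightarrow> ('a::euclidean_space \<Rightarrow> real) \<Rightarrow> bool" where
  "times_cont_diff 0 f \<longleftrightarrow> continuous_on UNIV f"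
| "times_cont_diff (Suc k) f \<longleftrightarrow>
     f differentiable_on UNIV \<and> (\<forall>b\<in>Basis. times_cont_diff k (partial_deriv b f))"

(* Elements of C_0^infinity(Omega) are represented by their extensions by zero to the whole space. *)
definition test_functions :: "'a::euclidean_space set \<Rightarrow> ('a \<Rightarrow> real) set" where
  "test_functions \<Omega> =
     {\<psi>. (\<forall>k. times_cont_diff k \<psi>) \<and>
         compact (closure {x. \<psi> x \<noteq> 0}) \<and> closure {x. \<psi> x \<noteq> 0} \<subseteq> \<Omega>}"

(* Membership in these spaces depends only on the values on Omega, so a function defined on a
   larger set need not be restricted explicitly. *)
definition Lp_space :: "real \<Rightarrow> 'a::euclidean_space set \<Rightarrow> ('a \<Rightarrow> real) set" where
  "Lp_space p \<Omega> =
     {u. u \<in> borel_measurable (lebesgue_on \<Omega>) \<and>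
         integrable (lebesgue_on \<Omega>) (\<lambda>x. \<bar>u x\<bar> powr p)}"

definition weak_partial_deriv ::
    "'a::euclidean_space set \<Rightarrow> 'a \<Rightarrow> ('a \<Rightarrow> real) \<Rightarrow> ('a \<Rightarrow> real) \<Rightarrow> bool" where
  "weak_partial_deriv \<Omega> b u g \<longleftrightarrow>
     (\<forall>\<psi>\<in>test_functions \<Omega>.
        (LINT x|lebesgue_on \<Omega>. u x * partial_deriv b \<psi> x) =
        - (LINT x|lebesgue_on \<Omega>. \<psi> x * g x))"

definition W1p_space :: "real \<Rightarrow> 'a::euclidean_space set \<Rightarrow> ('a \<Rightarrow> real) set" where
  "W1p_space p \<Omega> =
     {u \<in> Lp_space p \<Omega>. \<forall>b\<in>Basis. \<exists>g\<in>Lp_space p \<Omega>. weak_partial_deriv \<Omega> b u g}"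

(* Meant for compact K, so that the complement of K is open. *)
definition W1p_removable_for_continuous :: "real \<Rightarrow> (real \<times> real) set \<Rightarrow> bool" where
  "W1p_removable_for_continuous p K \<longleftrightarrow>
     (\<forall>u. continuous_on UNIV u \<and> u \<in> W1p_space p (UNIV - K) \<longrightarrow> u \<in> W1p_space p UNIV)"

end

theory Submission
  imports Defs
begin

text \<open>
  The graph \<open>\<Gamma>\<close> contains a self-affine Cantor set \<open>K\<^sub>0\<close>, and the exceptional function is \<open>u (x, y)\<close>,
  the mass up to abscissa \<open>x\<close> of a measure carried by the slice of \<open>K\<^sub>0\<close> at height \<open>y\<close>. As a
  distribution, \<open>\<partial>\<^sub>x u\<close> is a nonzero measure on \<open>K\<^sub>0\<close>. So \<open>\<partial>\<^sub>x u = 0\<close> off \<open>\<Gamma>\<close>, but \<open>\<partial>\<^sub>x u\<close> is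
  not a function, because \<open>\<Gamma>\<close> has measure zero. The point is to make \<open>u\<close> continuous with \<open>\<partial>\<^sub>y u\<close> in
  \<open>L\<^sup>p\<close>.

  The set \<open>K\<^sub>0\<close> is the intersection of the unions \<open>A n\<close> of the rectangles of generation \<open>n\<close>. Each
  rectangle contains \<open>N = (4 M + 1) k\<close> affine copies of itself, scaled by \<open>w = 1 / (4 N)\<close>
  horizontally and by \<open>1 / M\<close> vertically. The copies stand in separate columns. Their heights take
  \<open>4 M + 1\<close> values, \<open>k\<close> copies for each value. A point of \<open>K\<^sub>0\<close> is determined by its
  abscissa, and \<open>K\<^sub>0\<close> lies in the graph of a Hoelder \<open>\<alpha>\<close> function as soon as \<open>1 / M \<le> w\<^sup>\<alpha>\<close>
  (\<open>K0_holder\<close>, \<open>holder_extension\<close>).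

  The function satisfies \<open>u (z) = (\<Sum>i<N. c\<^sub>i (y) u (P\<^sub>i z))\<close>, where \<open>P\<^sub>i\<close> blows up the \<open>i\<close>-th copy to
  the full size. The heights of the copies overlap and the weights \<open>c\<^sub>i\<close>, of size \<open>1 / k\<close>, come from a
  smooth partition of unity, so that the total mass is preserved at every height (the refinement
  identity). Hence the approximations \<open>U n\<close> of \<open>u\<close> change only inside \<open>A n\<close>, by at most a multiple of
  \<open>k\<^sup>-\<^sup>n\<close>. Therefore \<open>u\<close> is continuous, it equals \<open>U n\<close> off \<open>A n\<close>, and there
  \<open>\<partial>\<^sub>x u = 0\<close> and \<open>\<bar>\<partial>\<^sub>y u\<bar> \<le> E \<gamma>\<^sup>n\<close> with \<open>\<gamma> = max 2 (M / k)\<close> (\<open>dU_bounded\<close>). By the Hoelder estimate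
  \<open>A n\<close> has measure at most \<open>16 / M\<^sup>n\<close>, and so \<open>\<partial>\<^sub>y u\<close> is in \<open>L\<^sup>p\<close> locally if \<open>\<gamma>\<^sup>p < M\<close>
  (\<open>integrable_powr_uy\<close>). For large \<open>M\<close> the two conditions say, up to constants, that
  \<open>M\<^bsup>1 - 1/p\<^esup> < k \<le> M\<^bsup>1/\<alpha> - 1\<^esup>\<close>. Such \<open>k\<close> exist exactly for \<open>\<alpha> < p / (2 p - 1)\<close> (\<open>exists_scales\<close>).

  After multiplication by a cutoff in \<open>x\<close>, the weak derivatives off \<open>\<Gamma>\<close> are computed by the
  fundamental theorem of calculus on horizontal and vertical lines. Suppose that \<open>g\<close> were a weak
  \<open>x\<close>-derivative on the whole plane. Smooth functions that vanish near \<open>K\<^sub>0\<close> and equal \<open>1\<close> off \<open>A n\<close> come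
  from the same self-affine scheme. Multiplying a test function by them and letting \<open>n\<close> tend to
  infinity shows that the derivative computed off \<open>\<Gamma>\<close>, in which \<open>\<partial>\<^sub>x u = 0\<close>, is also a weak derivative
  on the plane. This is false, since \<open>u\<close> rises from \<open>0\<close> for \<open>x \<le> 0\<close> to a nonzero bump in \<open>y\<close> for
  \<open>x \<ge> 1\<close> (\<open>v_notin_W1p_space\<close>).
\<close>

section \<open>Closure properties of smooth functions\<close>

lemma partial_deriv_eq:
  assumes "(f has_derivative f') (at x)"
  shows "partial_deriv b f x = f' b"
  using frechet_derivative_at[OF assms] by (simp add: partial_deriv_def)

lemma times_cont_diff_imp_continuous:
  "times_cont_diff k f \<Longrightarrow> continuous_on UNIV f"
  by (cases k) (auto intro: differentiable_imp_continuous_on)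

lemma times_cont_diff_SucD: "times_cont_diff (Suc k) f \<Longrightarrow> times_cont_diff k f"
proof (induction k arbitrary: f)
  case 0
  then show ?case by (auto intro: differentiable_imp_continuous_on)
next
  case (Suc k)
  have "f differentiable_on UNIV" using Suc.prems by simp
  moreover have "\<forall>b\<in>Basis. times_cont_diff (Suc k) (partial_deriv b f)"
    using Suc.prems unfolding times_cont_diff.simps(2)[of "Suc k" f] by blast
  then have "\<forall>b\<in>Basis. times_cont_diff k (partial_deriv b f)"
    using Suc.IH by blast
  ultimately show ?case by simp
qed

lemma times_cont_diff_Suc_has_derivative:
  "times_cont_diff (Suc k) f \<Longrightarrow> (f has_derivative frechet_derivative f (at x)) (at x)"
  using frechet_derivative_works[of f "at x"] by (auto simp: differentiable_on_def)

lemma times_cont_diff_const: "times_cont_diff k (\<lambda>x. c)"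
proof (induction k arbitrary: c)
  case (Suc k)
  have "partial_deriv b (\<lambda>x::'a. c) = (\<lambda>x. 0)" for b
    by (rule ext) (rule partial_deriv_eq[OF has_derivative_const])
  then show ?case using Suc by auto
qed auto

lemma times_cont_diff_add:
  "times_cont_diff k f \<Longrightarrow> times_cont_diff k g \<Longrightarrow> times_cont_diff k (\<lambda>x. f x + g x)"
proof (induction k arbitrary: f g)
  case 0
  then show ?case by (auto intro: continuous_intros)
next
  case (Suc k)
  have "partial_deriv b (\<lambda>x. f x + g x) = (\<lambda>x. partial_deriv b f x + partial_deriv b g x)" for b
    using has_derivative_add[OF times_cont_diff_Suc_has_derivative[OF Suc.prems(1)]
        times_cont_diff_Suc_has_derivative[OF Suc.prems(2)]]
    by (intro ext, subst partial_deriv_eq, assumption) (simp add: partial_deriv_def)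
  with Suc show ?case by (auto intro!: derivative_intros)
qed

lemma times_cont_diff_mult:
  "times_cont_diff k f \<Longrightarrow> times_cont_diff k g \<Longrightarrow> times_cont_diff k (\<lambda>x. f x * g x)"
proof (induction k arbitrary: f g)
  case 0
  then show ?case by (auto intro: continuous_intros)
next
  case (Suc k)
  have "partial_deriv b (\<lambda>x. f x * g x) = (\<lambda>x. f x * partial_deriv b g x + partial_deriv b f x * g x)" for b
    using has_derivative_mult[OF times_cont_diff_Suc_has_derivative[OF Suc.prems(1)]
        times_cont_diff_Suc_has_derivative[OF Suc.prems(2)]]
    by (intro ext, subst partial_deriv_eq, assumption) (simp add: partial_deriv_def)
  moreover have "times_cont_diff k f" "times_cont_diff k g"
    using Suc.prems times_cont_diff_SucD by blast+
  ultimately show ?case using Suc by (auto intro!: times_cont_diff_add differentiable_on_mult)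
qed

lemma times_cont_diff_sum:
  "(\<And>i. i \<in> I \<Longrightarrow> times_cont_diff k (f i)) \<Longrightarrow> times_cont_diff k (\<lambda>x. \<Sum>i\<in>I. f i x)"
  by (induction I rule: infinite_finite_induct)
    (auto intro!: times_cont_diff_add times_cont_diff_const)

lemma times_cont_diff_prod:
  "(\<And>i. i \<in> I \<Longrightarrow> times_cont_diff k (f i)) \<Longrightarrow> times_cont_diff k (\<lambda>x. \<Prod>i\<in>I. f i x)"
  by (induction I rule: infinite_finite_induct)
    (auto intro!: times_cont_diff_mult times_cont_diff_const)

lemma times_cont_diff_diff:
  assumes "times_cont_diff k f" "times_cont_diff k g"
  shows "times_cont_diff k (\<lambda>x. f x - g x)"
  using times_cont_diff_add[OF assms(1) times_cont_diff_mult[OF times_cont_diff_const[of k "-1"] assms(2)]]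
  by simp

lemma times_cont_diff_inverse:
  assumes "\<And>x. f x \<noteq> 0"
  shows "times_cont_diff k f \<Longrightarrow> times_cont_diff k (\<lambda>x. inverse (f x))"
proof (induction k)
  case 0
  then show ?case using assms by (auto intro!: continuous_intros)
next
  case (Suc k)
  have d: "((\<lambda>x. inverse (f x)) has_derivative
      (\<lambda>h. - (inverse (f x) * frechet_derivative f (at x) h * inverse (f x)))) (at x)" for x
    by (rule Deriv.has_derivative_inverse[OF assms times_cont_diff_Suc_has_derivative[OF Suc.prems]])
  have "partial_deriv b (\<lambda>x. inverse (f x)) =
      (\<lambda>x. (-1) * (inverse (f x) * partial_deriv b f x * inverse (f x)))" for b
    using partial_deriv_eq[OF d] by (auto simp: partial_deriv_def)
  moreover have "times_cont_diff k (\<lambda>x. inverse (f x))"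
    using Suc times_cont_diff_SucD by blast
  moreover have "(\<lambda>x. inverse (f x)) differentiable_on UNIV"
    using d by (auto simp: differentiable_on_def differentiable_def)
  moreover have "times_cont_diff k (\<lambda>x. (-1) * (inverse (f x) * partial_deriv b f x * inverse (f x)))"
    if "b \<in> Basis" for b
    using Suc.prems that calculation(2)
    by (intro times_cont_diff_mult times_cont_diff_const) auto
  ultimately show ?case by (simp only: times_cont_diff.simps(2)) blast
qed

text \<open>Composition with an affine map \<open>A\<close>, given by having the constant derivative \<open>L\<close>.\<close>

lemma times_cont_diff_compose_affine:
  fixes A :: "'a::euclidean_space \<Rightarrow> 'b::euclidean_space"
  assumes A: "\<And>z. (A has_derivative L) (at z)"
  shows "times_cont_diff k f \<Longrightarrow> times_cont_diff k (\<lambda>z. f (A z))"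
proof (induction k arbitrary: f)
  case 0
  have "continuous_on UNIV A"
    using A by (meson has_derivative_at_withinI has_derivative_continuous_on)
  then show ?case using 0 continuous_on_compose2[of UNIV f UNIV A] by auto
next
  case (Suc k)
  have d: "((\<lambda>z. f (A z)) has_derivative (\<lambda>h. frechet_derivative f (at (A z)) (L h))) (at z)" for z
    using diff_chain_at[OF A times_cont_diff_Suc_has_derivative[OF Suc.prems]] by (simp add: o_def)
  have "partial_deriv b (\<lambda>z. f (A z)) = (\<lambda>z. \<Sum>e\<in>Basis. (L b \<bullet> e) * partial_deriv e f (A z))" for b
  proof
    fix z
    interpret D: bounded_linear "frechet_derivative f (at (A z))"
      using times_cont_diff_Suc_has_derivative[OF Suc.prems] by (rule has_derivative_bounded_linear)
    have "partial_deriv b (\<lambda>z. f (A z)) z = frechet_derivative f (at (A z)) (\<Sum>e\<in>Basis. (L b \<bullet> e) *\<^sub>R e)"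
      using partial_deriv_eq[OF d] by (simp add: euclidean_representation)
    also have "\<dots> = (\<Sum>e\<in>Basis. (L b \<bullet> e) * partial_deriv e f (A z))"
      by (simp add: D.sum D.scaleR partial_deriv_def)
    finally show "partial_deriv b (\<lambda>z. f (A z)) z = (\<Sum>e\<in>Basis. (L b \<bullet> e) * partial_deriv e f (A z))" .
  qed
  moreover have "(\<lambda>z. f (A z)) differentiable_on UNIV"
    using d by (auto simp: differentiable_on_def differentiable_def)
  ultimately show ?case using Suc
    by (auto intro!: times_cont_diff_sum times_cont_diff_mult times_cont_diff_const)
qed

lemma has_field_derivative_partial_deriv_1:
  fixes f :: "real \<Rightarrow> real"
  assumes "times_cont_diff (Suc k) f"
  shows "(f has_field_derivative partial_deriv 1 f x) (at x)"
proof -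
  have d: "(f has_derivative frechet_derivative f (at x)) (at x)"
    using times_cont_diff_Suc_has_derivative[OF assms] .
  interpret D: bounded_linear "frechet_derivative f (at x)"
    using d by (rule has_derivative_bounded_linear)
  have "frechet_derivative f (at x) h = partial_deriv 1 f x * h" for h
    using D.scaleR[of h 1] by (simp add: partial_deriv_def mult.commute)
  then have "frechet_derivative f (at x) = (*) (partial_deriv 1 f x)" by (rule ext)
  with d show ?thesis by (simp add: has_field_derivative_def)
qed

section \<open>A smooth step and a smooth plateau function\<close>

text \<open>The functions \<open>exp (- 1 / t) / t\<^sup>m\<close>, extended by \<open>0\<close> to \<open>t \<le> 0\<close>. The denominator makes the
  family closed under differentiation, up to linear combinations.\<close>

definition flat_exp :: "nat \<Rightarrow> real \<Rightarrow> real" where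
  "flat_exp m t = (if t \<le> 0 then 0 else exp (- 1 / t) / t ^ m)"

lemma flat_exp_deriv:
  "(flat_exp m has_field_derivative flat_exp (m + 2) t - m * flat_exp (m + 1) t) (at t)"
proof -
  consider "t < 0" | "t = 0" | "t > 0" by linarith
  then show ?thesis
  proof cases
    case 1
    have "((\<lambda>t::real. 0) has_field_derivative 0) (at t)" by simp
    then have "(flat_exp m has_field_derivative 0) (at t)"
      by (rule has_field_derivative_transform_within_open[where S = "{..<0}"])
        (use 1 in \<open>auto simp: flat_exp_def\<close>)
    then show ?thesis using 1 by (simp add: flat_exp_def)
  next
    case 3
    have "((\<lambda>t. exp (- 1 / t) / t ^ m) has_field_derivative
        exp (- 1 / t) / t ^ (m + 2) - m * (exp (- 1 / t) / t ^ (m + 1))) (at t)"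
    proof -
      have d1: "((\<lambda>t. exp (- 1 / t)) has_field_derivative exp (- 1 / t) / t\<^sup>2) (at t)"
        using 3 by (auto intro!: derivative_eq_intros simp: power2_eq_square)
      have d2: "((\<lambda>t. t ^ m) has_field_derivative m * t ^ (m - 1)) (at t)"
        by (auto intro!: derivative_eq_intros)
      have "(exp (- 1 / t) / t\<^sup>2 * t ^ m - exp (- 1 / t) * (m * t ^ (m - 1))) / (t ^ m * t ^ m)
          = exp (- 1 / t) / t ^ (m + 2) - m * (exp (- 1 / t) / t ^ (m + 1))"
      proof (cases m)
        case 0
        then show ?thesis by (simp add: power2_eq_square)
      next
        case (Suc l)
        define E where "E = exp (- 1 / t)"
        have "(E / t\<^sup>2 * t ^ m - E * (m * t ^ l)) / (t ^ m * t ^ m)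
          = E / t ^ (m + 2) - m * (E / t ^ (m + 1))"
          using 3 by (simp add: Suc divide_simps power2_eq_square) (simp add: algebra_simps)
        then show ?thesis unfolding E_def by (simp add: Suc)
      qed
      with DERIV_quotient[OF d1 d2] 3 show ?thesis by (simp add: mult_ac power2_eq_square)
    qed
    then have "(flat_exp m has_field_derivative
        exp (- 1 / t) / t ^ (m + 2) - m * (exp (- 1 / t) / t ^ (m + 1))) (at t)"
      by (rule has_field_derivative_transform_within_open[where S = "{0<..}"])
        (use 3 in \<open>auto simp: flat_exp_def\<close>)
    then show ?thesis using 3 by (simp add: flat_exp_def)
  next
    case 2
    have "((\<lambda>x. (inverse x) ^ (m + 1) / exp (inverse x)) \<longlongrightarrow> (0::real)) (at_right 0)"
      by (rule filterlim_compose[OF tendsto_power_div_exp_0 filterlim_inverse_at_top_right])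
    then have "((flat_exp (m + 1)) \<longlongrightarrow> 0) (at_right 0)"
      by (rule Lim_transform_eventually)
        (auto simp: flat_exp_def eventually_at_filter exp_minus field_simps)
    moreover have "((flat_exp (m + 1)) \<longlongrightarrow> 0) (at_left 0)"
      by (rule Lim_transform_eventually[OF tendsto_const])
        (auto simp: flat_exp_def eventually_at_filter)
    ultimately have "((flat_exp (m + 1)) \<longlongrightarrow> 0) (at 0)"
      by (simp add: filterlim_split_at)
    then have "((\<lambda>y. (flat_exp m y - flat_exp m 0) / (y - 0)) \<longlongrightarrow> 0) (at 0)"
      by (rule Lim_transform_eventually) (auto simp: flat_exp_def eventually_at_filter)
    then show ?thesis
      using 2 by (simp add: has_field_derivative_iff flat_exp_def)
  qed
qed

lemma times_cont_diff_flat_exp: "times_cont_diff k (flat_exp m)"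
proof (induction k arbitrary: m)
  case 0
  show ?case
    using flat_exp_deriv by (simp add: continuous_at_imp_continuous_on DERIV_isCont[OF flat_exp_deriv])
next
  case (Suc k)
  have "partial_deriv 1 (flat_exp m) = (\<lambda>t. flat_exp (m + 2) t - m * flat_exp (m + 1) t)"
    using partial_deriv_eq[OF flat_exp_deriv[unfolded has_field_derivative_def]] by auto
  moreover have "flat_exp m differentiable_on UNIV"
    using flat_exp_deriv by (auto simp: differentiable_on_def real_differentiable_def)
  ultimately show ?case
    using Suc by (auto intro!: times_cont_diff_diff times_cont_diff_mult times_cont_diff_const)
qed

text \<open>A smooth function that is \<open>0\<close> on \<open>t \<le> 0\<close> and \<open>1\<close> on \<open>t \<ge> 1\<close>.\<close>

definition smooth_step :: "real \<Rightarrow> real" where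
  "smooth_step t = flat_exp 0 t * inverse (flat_exp 0 t + flat_exp 0 (1 - t))"

lemma smooth_step_denominator_pos: "flat_exp 0 t + flat_exp 0 (1 - t) > 0"
  by (auto simp: flat_exp_def add_pos_pos)

lemma times_cont_diff_smooth_step: "times_cont_diff k smooth_step"
proof -
  have "((\<lambda>t::real. 1 - t) has_derivative (\<lambda>h. - h)) (at z)" for z
    by (auto intro!: derivative_eq_intros)
  then have "times_cont_diff k (\<lambda>t. flat_exp 0 (1 - t))"
    by (rule times_cont_diff_compose_affine) (rule times_cont_diff_flat_exp)
  then have "times_cont_diff k (\<lambda>t. flat_exp 0 t * inverse (flat_exp 0 t + flat_exp 0 (1 - t)))"
    using smooth_step_denominator_pos
    by (intro times_cont_diff_mult times_cont_diff_inverse times_cont_diff_add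
        times_cont_diff_flat_exp) (auto simp: less_le)
  then show ?thesis unfolding smooth_step_def .
qed

lemma smooth_step_eq_0: "t \<le> 0 \<Longrightarrow> smooth_step t = 0"
  by (simp add: smooth_step_def flat_exp_def)

lemma smooth_step_eq_1: "t \<ge> 1 \<Longrightarrow> smooth_step t = 1"
  by (simp add: smooth_step_def flat_exp_def)

lemma smooth_step_bounds: "0 \<le> smooth_step t" "smooth_step t \<le> 1"
proof -
  have "0 \<le> flat_exp 0 t" "0 \<le> flat_exp 0 (1 - t)" by (auto simp: flat_exp_def)
  then show "0 \<le> smooth_step t" "smooth_step t \<le> 1"
    using smooth_step_denominator_pos[of t] by (auto simp: smooth_step_def field_simps)
qed

text \<open>A smooth function that is \<open>1\<close> on \<open>\<bar>t\<bar> \<le> 3 / 2\<close> and \<open>0\<close> on \<open>\<bar>t\<bar> \<ge> 2\<close>.\<close>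

definition plateau :: "real \<Rightarrow> real" where
  "plateau t = smooth_step (4 - 2 * t) * smooth_step (4 + 2 * t)"

lemma times_cont_diff_real_affine:
  fixes f :: "real \<Rightarrow> real"
  assumes "times_cont_diff k f"
  shows "times_cont_diff k (\<lambda>t. f (a * t + b))"
proof (rule times_cont_diff_compose_affine[OF _ assms])
  show "((\<lambda>t. a * t + b) has_derivative (\<lambda>h. a * h)) (at z)" for z
    by (auto intro!: derivative_eq_intros)
qed

lemma times_cont_diff_plateau: "times_cont_diff k plateau"
proof -
  have "times_cont_diff k (\<lambda>t. smooth_step (-2 * t + 4) * smooth_step (2 * t + 4))"
    by (intro times_cont_diff_mult times_cont_diff_real_affine times_cont_diff_smooth_step)
  moreover have "(\<lambda>t. smooth_step (-2 * t + 4) * smooth_step (2 * t + 4)) = plateau"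
    by (auto simp: plateau_def algebra_simps)
  ultimately show ?thesis by simp
qed

lemma plateau_eq_1: "\<bar>t\<bar> \<le> 3 / 2 \<Longrightarrow> plateau t = 1"
  by (simp add: plateau_def smooth_step_eq_1)

lemma plateau_eq_0: "\<bar>t\<bar> \<ge> 2 \<Longrightarrow> plateau t = 0"
  by (auto simp: plateau_def smooth_step_eq_0 abs_if split: if_splits)

lemma plateau_bounds: "0 \<le> plateau t" "plateau t \<le> 1"
  by (auto simp: plateau_def smooth_step_bounds mult_le_one)

lemma DERIV_plateau: "(plateau has_field_derivative partial_deriv 1 plateau y) (at y)"
  by (rule has_field_derivative_partial_deriv_1[OF times_cont_diff_plateau[of "Suc 0"]])

lemma continuous_on_plateau: "continuous_on S plateau"
  using times_cont_diff_imp_continuous[OF times_cont_diff_plateau[of 0]] continuous_on_subset by blast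

lemma continuous_on_deriv_plateau: "continuous_on S (partial_deriv 1 plateau)"
proof -
  have "times_cont_diff (Suc 0) plateau" by (rule times_cont_diff_plateau)
  then have "continuous_on UNIV (partial_deriv 1 plateau)" by simp
  then show ?thesis using continuous_on_subset by blast
qed

lemma deriv_plateau_eq_0:
  assumes "\<bar>t\<bar> \<ge> 2 \<or> \<bar>t\<bar> \<le> 3 / 2"
  shows "partial_deriv 1 plateau t = 0"
proof -
  have 1: "partial_deriv 1 plateau t = 0" if "t \<in> G" "open G" "\<And>s. s \<in> G \<Longrightarrow> plateau s = b" for t b G
  proof -
    have "((\<lambda>s. b) has_field_derivative 0) (at t)" by simp
    then have "(plateau has_field_derivative 0) (at t)"
      by (rule has_field_derivative_transform_within_open[OF _ that(2,1)]) (simp add: that)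
    with DERIV_plateau show ?thesis by (rule DERIV_unique)
  qed
  \<comment> \<open>The derivative vanishes in the open regions where the function is constant, hence by
    continuity on their closures.\<close>
  let ?S = "{s. partial_deriv 1 plateau s = 0}"
  have "closed ?S"
    by (rule closed_Collect_eq) (auto intro: continuous_on_deriv_plateau)
  have "{2<..} \<subseteq> ?S" "{..<-2} \<subseteq> ?S"
    by (auto intro: 1[of _ "{2<..}" 0] 1[of _ "{..<-2}" 0] simp: plateau_eq_0)
  moreover have "{-3/2<..<3/2} \<subseteq> ?S"
  proof
    fix s :: real assume "s \<in> {-3/2<..<3/2}"
    then have "partial_deriv 1 plateau s = 0"
      by (rule 1[of _ _ 1]) (auto simp: plateau_eq_1 abs_le_iff)
    then show "s \<in> ?S" by simp
  qed
  ultimately have "closure {2<..} \<subseteq> ?S" "closure {..<-2} \<subseteq> ?S" "closure {-3/2<..<3/2} \<subseteq> ?S"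
    using closure_minimal \<open>closed ?S\<close> by blast+
  then show ?thesis using assms by (auto simp: subset_iff abs_if split: if_splits)
qed

lemma deriv_bounded_of_bounded_support:
  fixes f :: "real \<Rightarrow> real"
  assumes f: "times_cont_diff (Suc 0) f" and zero: "\<And>t. \<bar>t\<bar> \<ge> R \<Longrightarrow> f t = 0"
  obtains L where "\<And>t. \<bar>partial_deriv 1 f t\<bar> \<le> L"
proof -
  have "continuous_on UNIV (partial_deriv 1 f)" using f by simp
  then have "compact (partial_deriv 1 f ` {-R..R})"
    by (intro compact_continuous_image) (auto intro: continuous_on_subset)
  then have "bounded (partial_deriv 1 f ` {-R..R})" by (rule compact_imp_bounded)
  then obtain L where "\<forall>x\<in>partial_deriv 1 f ` {-R..R}. norm x \<le> L"
    unfolding bounded_iff ..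
  then have L: "\<bar>partial_deriv 1 f t\<bar> \<le> L" if "t \<in> {-R..R}" for t
    using that by simp
  have "\<bar>partial_deriv 1 f t\<bar> \<le> max 0 L" for t
  proof (cases "t \<in> {-R..R}")
    case False
    then have t: "t \<in> - {-R..R}" by simp
    have "((\<lambda>s. 0) has_field_derivative 0) (at t)" by simp
    then have "(f has_field_derivative 0) (at t)"
    proof (rule has_field_derivative_transform_within_open[OF _ _ t])
      fix s assume "s \<in> - {-R..R}"
      then have "R \<le> \<bar>s\<bar>" by (simp add: not_le) linarith
      then show "0 = f s" by (simp add: zero)
    qed (auto intro: open_Compl)
    with has_field_derivative_partial_deriv_1[OF f] have "partial_deriv 1 f t = 0"
      by (rule DERIV_unique)
    then show ?thesis by simp
  next
    case True
    from L[OF this] show ?thesis by simp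
  qed
  then show ?thesis by (rule that)
qed

text \<open>A bump supported in \<open>[-1, 1]\<close> whose integer translates sum to \<open>1\<close>, because the sum telescopes.\<close>

definition smooth_hat :: "real \<Rightarrow> real" where
  "smooth_hat t = smooth_step (t + 1) - smooth_step t"

lemma smooth_hat_eq_0: "1 \<le> \<bar>t\<bar> \<Longrightarrow> smooth_hat t = 0"
  by (cases "0 \<le> t") (simp_all add: smooth_hat_def smooth_step_eq_0 smooth_step_eq_1)

lemma smooth_hat_bound: "\<bar>smooth_hat t\<bar> \<le> 1"
  using smooth_step_bounds[of t] smooth_step_bounds[of "t + 1"] by (simp add: smooth_hat_def abs_le_iff)

lemma times_cont_diff_smooth_hat: "times_cont_diff k smooth_hat"
  using times_cont_diff_diff[OF times_cont_diff_real_affine[OF times_cont_diff_smooth_step, of k 1 1]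
      times_cont_diff_smooth_step[of k]]
  by (simp add: smooth_hat_def[abs_def])

text \<open>On \<open>\<bar>y\<bar> \<le> 2\<close> the translates by the integers from \<open>- 2 m\<close> to \<open>2 m\<close> already suffice.\<close>

lemma sum_smooth_hat:
  assumes "\<bar>y\<bar> \<le> 2"
  shows "(\<Sum>l<4 * m + 1. smooth_hat (real m * y - (real l - 2 * real m))) = 1"
proof -
  define f where "f l = smooth_step (real m * y + 2 * real m + 1 - real l)" for l :: nat
  have "(\<Sum>l<4 * m + 1. smooth_hat (real m * y - (real l - 2 * real m))) = (\<Sum>l<4 * m + 1. f l - f (Suc l))"
    by (intro sum.cong refl) (simp add: smooth_hat_def f_def algebra_simps)
  also have "\<dots> = f 0 - f (4 * m + 1)" by (rule sum_lessThan_telescope')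
  also have "f 0 = 1"
  proof -
    have "0 \<le> real m * (y + 2)" using assms by (intro mult_nonneg_nonneg) auto
    then show ?thesis by (simp add: f_def smooth_step_eq_1 algebra_simps)
  qed
  also have "f (4 * m + 1) = 0"
  proof -
    have "real m * (y - 2) \<le> 0" using assms by (intro mult_nonneg_nonpos) auto
    then show ?thesis by (simp add: f_def smooth_step_eq_0 algebra_simps)
  qed
  finally show ?thesis by simp
qed

section \<open>Test functions of two variables\<close>

lemma times_cont_diff_compose_fst:
  "times_cont_diff k f \<Longrightarrow> times_cont_diff k (\<lambda>z::real \<times> real. f (fst z))"
  by (rule times_cont_diff_compose_affine[where L = fst]) (auto intro!: derivative_eq_intros)

lemma times_cont_diff_compose_snd:
  "times_cont_diff k f \<Longrightarrow> times_cont_diff k (\<lambda>z::real \<times> real. f (snd z))"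
  by (rule times_cont_diff_compose_affine[where L = snd]) (auto intro!: derivative_eq_intros)

lemma test_functions_differentiable:
  assumes "\<psi> \<in> test_functions \<Omega>"
  shows "(\<psi> has_derivative frechet_derivative \<psi> (at z)) (at z)"
  using assms times_cont_diff_Suc_has_derivative unfolding test_functions_def by blast

lemma test_functions_continuous:
  "\<psi> \<in> test_functions \<Omega> \<Longrightarrow> continuous_on UNIV \<psi>"
  by (auto simp: test_functions_def dest: times_cont_diff_imp_continuous)

lemma test_functions_continuous_partial:
  assumes "\<psi> \<in> test_functions \<Omega>" "b \<in> Basis"
  shows "continuous_on UNIV (partial_deriv b \<psi>)"
proof -
  have "times_cont_diff (Suc 0) \<psi>" using assms unfolding test_functions_def by blast
  then show ?thesis using assms by simp
qed

lemma test_functions_zero: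
  assumes "z \<notin> closure {x. \<psi> x \<noteq> 0}"
  shows "\<psi> z = 0" "partial_deriv b \<psi> z = 0"
proof -
  show "\<psi> z = 0" using assms closure_subset[of "{x. \<psi> x \<noteq> 0}"] by auto
  have "((\<lambda>x. 0) has_derivative (\<lambda>h. 0)) (at z)" by simp
  then have "(\<psi> has_derivative (\<lambda>h. 0)) (at z)"
    by (rule has_derivative_transform_within_open[where s = "- closure {x. \<psi> x \<noteq> 0}"])
      (use assms closure_subset[of "{x. \<psi> x \<noteq> 0}"] in auto)
  then show "partial_deriv b \<psi> z = 0" by (simp add: partial_deriv_eq)
qed

lemma test_functions_bounded_support:
  assumes "\<psi> \<in> test_functions \<Omega>"
  obtains R where "R > 0" "closure {x. \<psi> x \<noteq> 0} \<subseteq> ball 0 R"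
proof -
  have "bounded (closure {x. \<psi> x \<noteq> 0})"
    using assms by (auto simp: test_functions_def compact_imp_bounded)
  then obtain R where "R > 0" "closure {x. \<psi> x \<noteq> 0} \<subseteq> ball 0 R"
    by (meson bounded_subset_ballD)
  then show ?thesis using that by blast
qed

lemma test_functions_mono:
  "\<psi> \<in> test_functions \<Omega> \<Longrightarrow> \<Omega> \<subseteq> \<Omega>' \<Longrightarrow> \<psi> \<in> test_functions \<Omega>'"
  by (auto simp: test_functions_def)

text \<open>Multiplication by a smooth function that vanishes near \<open>K\<close> moves the support off \<open>K\<close>.\<close>

lemma test_functions_mult_cutoff:
  assumes \<psi>: "\<psi> \<in> test_functions UNIV" and X: "\<And>k. times_cont_diff k X"
    and "open G" "K \<subseteq> G" "\<And>z. z \<in> G \<Longrightarrow> X z = 0"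
  shows "(\<lambda>z. \<psi> z * X z) \<in> test_functions (UNIV - K)"
proof -
  have sub: "closure {z. \<psi> z * X z \<noteq> 0} \<subseteq> closure {z. \<psi> z \<noteq> 0} \<inter> - G"
    by (rule closure_minimal) (use assms closure_subset[of "{z. \<psi> z \<noteq> 0}"] in auto)
  have "compact (closure {z. \<psi> z \<noteq> 0} \<inter> closure {z. \<psi> z * X z \<noteq> 0})"
    using \<psi> by (intro compact_Int_closed) (auto simp: test_functions_def)
  moreover have "closure {z. \<psi> z \<noteq> 0} \<inter> closure {z. \<psi> z * X z \<noteq> 0} = closure {z. \<psi> z * X z \<noteq> 0}"
    using sub by blast
  moreover have "\<forall>k. times_cont_diff k (\<lambda>z. \<psi> z * X z)"
    using \<psi> X by (auto simp: test_functions_def intro!: times_cont_diff_mult)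
  ultimately show ?thesis
    using sub assms(4) unfolding test_functions_def by auto
qed

lemma partial_deriv_fst:
  assumes "(\<psi> has_derivative D) (at (x, y))"
  shows "((\<lambda>x. \<psi> (x, y)) has_field_derivative partial_deriv (1, 0) \<psi> (x, y)) (at x)"
proof -
  interpret D: bounded_linear D using assms by (rule has_derivative_bounded_linear)
  have "((\<lambda>x. (x, y)) has_derivative (\<lambda>h. (h, 0))) (at x)"
    by (auto intro!: derivative_eq_intros)
  from diff_chain_at[OF this assms] have "((\<lambda>x. \<psi> (x, y)) has_derivative (\<lambda>h. D (h, 0))) (at x)"
    by (simp add: o_def)
  moreover have "D (h, 0) = partial_deriv (1, 0) \<psi> (x, y) * h" for h
    using D.scaleR[of h "(1, 0)"] partial_deriv_eq[OF assms] by (simp add: mult.commute)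
  ultimately show ?thesis by (simp add: has_field_derivative_def)
qed

lemma partial_deriv_snd:
  assumes "(\<psi> has_derivative D) (at (x, y))"
  shows "((\<lambda>y. \<psi> (x, y)) has_field_derivative partial_deriv (0, 1) \<psi> (x, y)) (at y)"
proof -
  interpret D: bounded_linear D using assms by (rule has_derivative_bounded_linear)
  have "((\<lambda>y. (x, y)) has_derivative (\<lambda>h. (0, h))) (at y)"
    by (auto intro!: derivative_eq_intros)
  from diff_chain_at[OF this assms] have "((\<lambda>y. \<psi> (x, y)) has_derivative (\<lambda>h. D (0, h))) (at y)"
    by (simp add: o_def)
  moreover have "D (0, h) = partial_deriv (0, 1) \<psi> (x, y) * h" for h
    using D.scaleR[of h "(0, 1)"] partial_deriv_eq[OF assms] by (simp add: mult.commute)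
  ultimately show ?thesis by (simp add: has_field_derivative_def)
qed

section \<open>Hoelder functions and their graphs\<close>

lemma powr_subadditive:
  fixes a b \<alpha> :: real
  assumes "0 \<le> a" "0 \<le> b" "0 < \<alpha>" "\<alpha> \<le> 1"
  shows "(a + b) powr \<alpha> \<le> a powr \<alpha> + b powr \<alpha>"
proof (cases "a + b = 0")
  case True
  then show ?thesis by simp
next
  case False
  with assms have pos: "a + b > 0" by simp
  have *: "t \<le> t powr \<alpha>" if "0 \<le> t" "t \<le> 1" for t :: real
    using powr_mono'[of \<alpha> 1 t] assms that by simp
  have "1 = a / (a + b) + b / (a + b)"
    using pos by (simp add: add_divide_distrib[symmetric])
  also have "\<dots> \<le> (a / (a + b)) powr \<alpha> + (b / (a + b)) powr \<alpha>"
    using assms pos by (intro add_mono *) auto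
  also have "\<dots> = (a powr \<alpha> + b powr \<alpha>) / (a + b) powr \<alpha>"
    using assms pos by (simp add: powr_divide add_divide_distrib)
  finally show ?thesis using pos by (simp add: field_simps)
qed

text \<open>McShane's extension theorem: a Hoelder function on a subset of the line, here given by its
  graph \<open>K\<close>, extends to the whole line.\<close>

lemma holder_extension:
  fixes K :: "(real \<times> real) set"
  assumes \<alpha>: "0 < \<alpha>" "\<alpha> \<le> 1" and "0 \<le> C"
    and K: "\<And>z z'. z \<in> K \<Longrightarrow> z' \<in> K \<Longrightarrow> \<bar>snd z - snd z'\<bar> \<le> C * \<bar>fst z - fst z'\<bar> powr \<alpha>"
  obtains f :: "real \<Rightarrow> real"
  where "\<And>x y. \<bar>f x - f y\<bar> \<le> C * \<bar>x - y\<bar> powr \<alpha>" "\<And>z. z \<in> K \<Longrightarrow> f (fst z) = snd z"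
proof (cases "K = {}")
  case True
  show ?thesis by (rule that[of "\<lambda>x. 0"]) (use True \<open>0 \<le> C\<close> in auto)
next
  case False
  have tri: "C * \<bar>x - y\<bar> powr \<alpha> \<le> C * \<bar>x - t\<bar> powr \<alpha> + C * \<bar>t - y\<bar> powr \<alpha>" for x y t
  proof -
    have "\<bar>x - y\<bar> powr \<alpha> \<le> (\<bar>x - t\<bar> + \<bar>t - y\<bar>) powr \<alpha>"
      using \<alpha> by (intro powr_mono2) auto
    also have "\<dots> \<le> \<bar>x - t\<bar> powr \<alpha> + \<bar>t - y\<bar> powr \<alpha>"
      using \<alpha> by (intro powr_subadditive) auto
    finally show ?thesis using \<open>0 \<le> C\<close> by (metis distrib_left mult_left_mono)
  qed
  define f where "f x = (INF z\<in>K. snd z + C * \<bar>x - fst z\<bar> powr \<alpha>)" for x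
  have bdd: "bdd_below ((\<lambda>z. snd z + C * \<bar>x - fst z\<bar> powr \<alpha>) ` K)" for x
  proof -
    from False obtain z0 where z0: "z0 \<in> K" by blast
    have "snd z0 - C * \<bar>fst z0 - x\<bar> powr \<alpha> \<le> snd z + C * \<bar>x - fst z\<bar> powr \<alpha>" if "z \<in> K" for z
      using K[OF z0 that] tri[of "fst z0" "fst z" x] by linarith
    then show ?thesis by (rule bdd_belowI2)
  qed
  have le: "f x \<le> f y + C * \<bar>x - y\<bar> powr \<alpha>" for x y
  proof -
    have "f x - C * \<bar>x - y\<bar> powr \<alpha> \<le> f y"
      unfolding f_def[of y]
    proof (rule cINF_greatest[OF False])
      fix z assume "z \<in> K"
      then have "f x \<le> snd z + C * \<bar>x - fst z\<bar> powr \<alpha>"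
        unfolding f_def by (intro cINF_lower bdd)
      then show "f x - C * \<bar>x - y\<bar> powr \<alpha> \<le> snd z + C * \<bar>y - fst z\<bar> powr \<alpha>"
        using tri[of x "fst z" y] by linarith
    qed
    then show ?thesis by simp
  qed
  show ?thesis
  proof (rule that[of f])
    show "\<bar>f x - f y\<bar> \<le> C * \<bar>x - y\<bar> powr \<alpha>" for x y
      using le[of x y] le[of y x] by (simp add: abs_minus_commute abs_le_iff)
    fix z assume z: "z \<in> K"
    have "f (fst z) \<le> snd z"
      using cINF_lower[OF bdd z, of "fst z"] \<alpha> by (simp add: f_def)
    moreover have "snd z \<le> f (fst z)"
      unfolding f_def
    proof (rule cINF_greatest[OF False])
      fix z' assume "z' \<in> K"
      from K[OF z this] show "snd z \<le> snd z' + C * \<bar>fst z - fst z'\<bar> powr \<alpha>" by linarith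
    qed
    ultimately show "f (fst z) = snd z" by simp
  qed
qed

lemma closed_continuous_graph:
  fixes f :: "real \<Rightarrow> real"
  assumes "\<And>x y. \<bar>f x - f y\<bar> \<le> C * \<bar>x - y\<bar> powr \<alpha>" "0 < \<alpha>"
  shows "closed {(x, f x) | x. x \<in> {0..1}}"
proof -
  have "isCont f x" for x
  proof -
    have "((\<lambda>y. \<bar>y - x\<bar>) \<longlongrightarrow> \<bar>x - x\<bar>) (at x)"
      by (intro tendsto_rabs tendsto_diff tendsto_ident_at tendsto_const)
    then have "((\<lambda>y. \<bar>y - x\<bar> powr \<alpha>) \<longlongrightarrow> 0 powr \<alpha>) (at x)"
      using \<open>0 < \<alpha>\<close> by (intro tendsto_powr2 tendsto_const) auto
    from tendsto_mult_left[OF this, of C]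
    have "((\<lambda>y. C * \<bar>y - x\<bar> powr \<alpha>) \<longlongrightarrow> 0) (at x)" by simp
    then have "((\<lambda>y. f y - f x) \<longlongrightarrow> 0) (at x)"
      by (rule Lim_null_comparison[rotated]) (simp add: assms(1))
    then show ?thesis by (simp add: isCont_def LIM_zero_iff)
  qed
  then have "compact ((\<lambda>x. (x, f x)) ` {0..1})"
    by (intro compact_continuous_image continuous_on_Pair continuous_on_id
        continuous_at_imp_continuous_on compact_Icc) blast
  moreover have "(\<lambda>x. (x, f x)) ` {0..1} = {(x, f x) | x. x \<in> {0..1}}" by auto
  ultimately have "compact {(x, f x) | x. x \<in> {0..1}}" by (simp only:)
  then show ?thesis by (rule compact_imp_closed)
qed

text \<open>By Fubini's theorem, since each vertical slice has at most one point.\<close>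

lemma null_sets_continuous_graph:
  fixes f :: "real \<Rightarrow> real"
  assumes "closed {(x, f x) | x. x \<in> {0..1}}"
  shows "{(x, f x) | x. x \<in> {0..1}} \<in> null_sets lborel"
proof -
  let ?G = "{(x, f x) | x. x \<in> {0..1}}"
  have meas: "?G \<in> sets (lborel \<Otimes>\<^sub>M lborel)"
    using borel_closed[OF assms] by (simp only: lborel_prod sets_lborel)
  have slice: "emeasure lborel (Pair x -` ?G) = 0" for x
  proof -
    have "Pair x -` ?G \<subseteq> {f x}" by auto
    then have "countable (Pair x -` ?G)" by (rule countable_subset) simp
    then show ?thesis by (rule emeasure_lborel_countable)
  qed
  then have "emeasure (lborel \<Otimes>\<^sub>M lborel) ?G = 0"
    by (simp only: lborel.emeasure_pair_measure_alt[OF meas] slice nn_integral_const mult_zero_left)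
  with meas have "?G \<in> null_sets (lborel \<Otimes>\<^sub>M lborel)" by (rule null_setsI[rotated])
  then show ?thesis by (simp only: lborel_prod)
qed

section \<open>The self-affine rectangles\<close>

text \<open>The geometric data of the construction: \<open>N\<close> columns with left ends \<open>a i\<close> and width \<open>w\<close>, separated by
  gaps of width at least \<open>w\<close>, and vertical offsets \<open>j i\<close>. The margins in the assumptions on \<open>a\<close>, \<open>M\<close>
  and \<open>j\<close> keep the rectangles of the first generation well inside the initial one. The last
  assumption is what makes the limit set a Hoelder \<open>\<alpha>\<close> graph.\<close>

locale self_affine_rectangles =
  fixes N :: nat and a j :: "nat \<Rightarrow> real" and w M \<alpha> :: real
  assumes w_pos: "0 < w"
    and separated: "i < N \<Longrightarrow> i' < N \<Longrightarrow> i \<noteq> i' \<Longrightarrow> 2 * w \<le> \<bar>a i - a i'\<bar>"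
    and a_lower: "i < N \<Longrightarrow> 1 / 4 \<le> a i"
    and a_upper: "i < N \<Longrightarrow> a i + w \<le> 3 / 4"
    and M_ge_5: "5 \<le> M"
    and offset_bound: "i < N \<Longrightarrow> \<bar>j i\<bar> \<le> 2 * M"
    and \<alpha>_pos: "0 < \<alpha>" and \<alpha>_le_1: "\<alpha> \<le> 1"
    and holder_scale: "1 \<le> M * w powr \<alpha>"
begin

text \<open>The affine map that blows up the \<open>i\<close>-th rectangle of the first generation to the initial one.\<close>

definition P :: "nat \<Rightarrow> real \<times> real \<Rightarrow> real \<times> real" where
  "P i z = ((fst z - a i) / w, M * snd z - j i)"

lemma fst_P [simp]: "fst (P i z) = (fst z - a i) / w"
  and snd_P [simp]: "snd (P i z) = M * snd z - j i"
  by (auto simp: P_def)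

text \<open>The union of the closed rectangles of generation \<open>n\<close>.\<close>

primrec A :: "nat \<Rightarrow> (real \<times> real) set" where
  "A 0 = {0..1} \<times> {-4..4}"
| "A (Suc n) = (\<Union>i<N. P i -` A n)"

text \<open>The limit set.\<close>

definition K0 :: "(real \<times> real) set" where
  "K0 = (\<Inter>n. A n)"

lemma has_derivative_P: "(P i has_derivative (\<lambda>h. (fst h / w, M * snd h))) (at z)"
  unfolding P_def[abs_def] by (auto intro!: derivative_eq_intros simp: divide_inverse)

lemma continuous_on_P: "continuous_on S (P i)"
  unfolding P_def[abs_def] using w_pos by (auto intro!: continuous_intros)

lemma closed_A: "closed (A n)"
proof (induction n)
  case 0
  show ?case by (simp add: closed_Times)
next
  case (Suc n)
  then show ?case by (auto intro!: closed_UN closed_vimage continuous_on_P)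
qed

lemma P_in_A0D:
  assumes "P i z \<in> A 0" "i < N"
  shows "1 / 4 \<le> fst z" "fst z \<le> 3 / 4" "\<bar>snd z\<bar> < 3"
proof -
  have "0 \<le> (fst z - a i) / w" "(fst z - a i) / w \<le> 1" "\<bar>M * snd z - j i\<bar> \<le> 4"
    using assms by (auto simp: P_def)
  then have "0 \<le> fst z - a i" "fst z - a i \<le> w" using w_pos by (auto simp: zero_le_divide_iff)
  then show "1 / 4 \<le> fst z" "fst z \<le> 3 / 4"
    using a_lower[OF assms(2)] a_upper[OF assms(2)] by auto
  have "M * \<bar>snd z\<bar> = \<bar>M * snd z\<bar>" using M_ge_5 by (simp add: abs_mult)
  also have "\<dots> \<le> 4 + 2 * M"
    using \<open>\<bar>M * snd z - j i\<bar> \<le> 4\<close> offset_bound[OF assms(2)] by linarith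
  also have "\<dots> < M * 3" using M_ge_5 by simp
  finally show "\<bar>snd z\<bar> < 3" using M_ge_5 by simp
qed

lemma A_Suc_subset: "A (Suc n) \<subseteq> A n"
proof (induction n)
  case 0
  show ?case
  proof
    fix z assume "z \<in> A (Suc 0)"
    then obtain i where "i < N" "P i z \<in> A 0" by auto
    from P_in_A0D[OF this(2,1)] show "z \<in> A 0" by (cases z) auto
  qed
next
  case (Suc n)
  have "P i z \<in> A n" if "P i z \<in> A (Suc n)" for i z
    using that Suc by blast
  then show ?case unfolding A.simps(2)[of "Suc n"] A.simps(2)[of n] by blast
qed

lemma A_antimono: "m \<le> n \<Longrightarrow> A n \<subseteq> A m"
  by (rule lift_Suc_antimono_le[of A]) (auto simp: A_Suc_subset simp del: A.simps)

lemma A_subset_A0: "A n \<subseteq> A 0"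
  using A_antimono by blast

lemma closed_K0: "closed K0"
  unfolding K0_def by (intro closed_INT ballI closed_A)

lemma column_unique:
  assumes "i < N" "i' < N" "0 \<le> fst (P i z)" "fst (P i z) \<le> 1" "0 \<le> fst (P i' z)" "fst (P i' z) \<le> 1"
  shows "i = i'"
proof (rule ccontr)
  assume "i \<noteq> i'"
  from separated[OF assms(1,2) this] have "2 * w \<le> \<bar>a i - a i'\<bar>" .
  moreover have "0 \<le> fst z - a i" "fst z - a i \<le> w" "0 \<le> fst z - a i'" "fst z - a i' \<le> w"
    using assms(3-6) w_pos by (simp_all add: zero_le_divide_iff)
  ultimately show False using w_pos by linarith
qed

text \<open>A sum over the columns has at most one nonzero term at \<open>z\<close> if the \<open>i\<close>-th term vanishes outside
  the \<open>i\<close>-th column. This is why sup norms gain the factor of a single weight in each generation.\<close>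

lemma sum_single_column:
  fixes t :: "nat \<Rightarrow> real"
  assumes "\<And>i. i < N \<Longrightarrow> \<not> (0 \<le> fst (P i z) \<and> fst (P i z) \<le> 1) \<Longrightarrow> t i = 0"
    and "\<And>i. i < N \<Longrightarrow> \<bar>t i\<bar> \<le> b" "0 \<le> b"
  shows "\<bar>\<Sum>i<N. t i\<bar> \<le> b"
proof (cases "\<exists>i<N. 0 \<le> fst (P i z) \<and> fst (P i z) \<le> 1")
  case True
  then obtain i where i: "i < N" "0 \<le> fst (P i z)" "fst (P i z) \<le> 1" by blast
  have "(\<Sum>l<N. t l) = (\<Sum>l\<in>{i}. t l)"
  proof (rule sum.mono_neutral_right)
    show "\<forall>l\<in>{..<N} - {i}. t l = 0"
      using assms(1) column_unique[OF i(1) _ i(2,3)] by blast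
  qed (use i in auto)
  then show ?thesis using assms(2)[OF i(1)] by simp
next
  case False
  then have "(\<Sum>l<N. t l) = 0" using assms(1) by (intro sum.neutral) auto
  then show ?thesis using assms(3) by simp
qed

text \<open>Two points in the same column are blown up by \<open>P\<close>, which gains a factor \<open>M\<close> in height against
  \<open>w\<^sup>-\<^sup>\<alpha> \<le> M\<close> in width. In distinct columns their distance is at least \<open>w\<close>, while the heights differ
  by at most \<open>8\<close>.\<close>

lemma A_holder:
  assumes "z \<in> A n" "z' \<in> A n"
  shows "\<bar>snd z - snd z'\<bar> \<le> max (8 * w powr (-\<alpha>) * \<bar>fst z - fst z'\<bar> powr \<alpha>) (8 / M ^ n)"
  using assms
proof (induction n arbitrary: z z')
  case 0
  then have "\<bar>snd z - snd z'\<bar> \<le> 8" by auto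
  then show ?case by simp
next
  case (Suc n)
  from Suc.prems obtain i i' where i: "i < N" "P i z \<in> A n" and i': "i' < N" "P i' z' \<in> A n"
    by auto
  show ?case
  proof (cases "i = i'")
    case False
    have *: "0 \<le> fst (P i z)" "fst (P i z) \<le> 1" "0 \<le> fst (P i' z')" "fst (P i' z') \<le> 1"
      using subsetD[OF A_subset_A0 i(2)] subsetD[OF A_subset_A0 i'(2)] by (auto simp: mem_Times_iff)
    then have "0 \<le> fst z - a i" "fst z - a i \<le> w" "0 \<le> fst z' - a i'" "fst z' - a i' \<le> w"
      using w_pos by (auto simp: zero_le_divide_iff)
    then have "w \<le> \<bar>fst z - fst z'\<bar>"
      using separated[OF i(1) i'(1) False] by linarith
    then have "w powr \<alpha> \<le> \<bar>fst z - fst z'\<bar> powr \<alpha>"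
      using w_pos \<alpha>_pos by (intro powr_mono2) auto
    then have "w powr (-\<alpha>) * w powr \<alpha> \<le> w powr (-\<alpha>) * \<bar>fst z - fst z'\<bar> powr \<alpha>"
      by (intro mult_left_mono) auto
    moreover have "w powr (-\<alpha>) * w powr \<alpha> = 1"
      using w_pos by (simp add: powr_minus field_simps)
    moreover have "\<bar>snd z - snd z'\<bar> \<le> 8"
      using subsetD[OF A_subset_A0 Suc.prems(1)] subsetD[OF A_subset_A0 Suc.prems(2)]
      by (auto simp: mem_Times_iff)
    ultimately show ?thesis by simp
  next
    case True
    let ?C = "8 * w powr (-\<alpha>)"
    have "M * \<bar>snd z - snd z'\<bar> = \<bar>snd (P i z) - snd (P i z')\<bar>"
      using M_ge_5 by (simp add: abs_mult[symmetric] right_diff_distrib) (simp add: abs_mult right_diff_distrib[symmetric])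
    also have "\<dots> \<le> max (?C * \<bar>fst (P i z) - fst (P i z')\<bar> powr \<alpha>) (8 / M ^ n)"
      using Suc.IH[OF i(2) i'(2)[folded True]] .
    also have "\<bar>fst (P i z) - fst (P i z')\<bar> = \<bar>fst z - fst z'\<bar> / w"
      using w_pos by (simp add: diff_divide_distrib[symmetric])
    also have "(\<bar>fst z - fst z'\<bar> / w) powr \<alpha> = \<bar>fst z - fst z'\<bar> powr \<alpha> / w powr \<alpha>"
      using w_pos by (simp add: powr_divide)
    finally have "M * \<bar>snd z - snd z'\<bar>
        \<le> max (?C * (\<bar>fst z - fst z'\<bar> powr \<alpha> / w powr \<alpha>)) (8 / M ^ n)" .
    also have "\<dots> \<le> max (M * (?C * \<bar>fst z - fst z'\<bar> powr \<alpha>)) (8 / M ^ n)"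
    proof -
      have "1 / w powr \<alpha> \<le> M" using holder_scale w_pos by (simp add: divide_simps)
      from mult_right_mono[OF this, of "?C * \<bar>fst z - fst z'\<bar> powr \<alpha>"]
      show ?thesis by (intro max.mono) auto
    qed
    also have "8 / M ^ n = M * (8 / M ^ Suc n)" using M_ge_5 by simp
    finally have "M * \<bar>snd z - snd z'\<bar> \<le> M * max (?C * \<bar>fst z - fst z'\<bar> powr \<alpha>) (8 / M ^ Suc n)"
      using M_ge_5 by (simp only: max_mult_distrib_left) simp
    then show ?thesis using M_ge_5 by simp
  qed
qed

lemma pow_M_tendsto_0: "(\<lambda>n. c / M ^ n) \<longlonglongrightarrow> 0"
proof -
  have "(\<lambda>n. c * (1 / M) ^ n) \<longlonglongrightarrow> c * 0"
    using M_ge_5 by (intro tendsto_mult_left LIMSEQ_power_zero) auto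
  then show ?thesis by (simp add: power_one_over)
qed

lemma K0_holder:
  assumes "z \<in> K0" "z' \<in> K0"
  shows "\<bar>snd z - snd z'\<bar> \<le> 8 * w powr (-\<alpha>) * \<bar>fst z - fst z'\<bar> powr \<alpha>"
proof (rule LIMSEQ_le_const)
  let ?b = "8 * w powr (-\<alpha>) * \<bar>fst z - fst z'\<bar> powr \<alpha>"
  have "(\<lambda>n. max ?b (8 / M ^ n)) \<longlonglongrightarrow> max ?b 0"
    by (intro tendsto_max tendsto_const pow_M_tendsto_0)
  then show "(\<lambda>n. max ?b (8 / M ^ n)) \<longlonglongrightarrow> ?b" by simp
  show "\<exists>n0. \<forall>n\<ge>n0. \<bar>snd z - snd z'\<bar> \<le> max ?b (8 / M ^ n)"
    using assms A_holder unfolding K0_def by blast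
qed

lemma K0_slice_unique: "(x, y) \<in> K0 \<Longrightarrow> (x, y') \<in> K0 \<Longrightarrow> y = y'"
  using K0_holder[of "(x, y)" "(x, y')"] \<alpha>_pos by simp

lemma K0_subset_holder_graph:
  obtains f :: "real \<Rightarrow> real" and C where
    "\<And>x y. \<bar>f x - f y\<bar> \<le> C * \<bar>x - y\<bar> powr \<alpha>" "K0 \<subseteq> {(x, f x) | x. x \<in> {0..1}}"
proof -
  have "0 \<le> 8 * w powr (-\<alpha>)" by simp
  from holder_extension[OF \<alpha>_pos \<alpha>_le_1 this K0_holder]
  obtain f where f: "\<And>x y. \<bar>f x - f y\<bar> \<le> 8 * w powr (-\<alpha>) * \<bar>x - y\<bar> powr \<alpha>"
    "\<And>z. z \<in> K0 \<Longrightarrow> f (fst z) = snd z"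
    by blast
  have "K0 \<subseteq> {(x, f x) | x. x \<in> {0..1}}"
  proof
    fix z assume z: "z \<in> K0"
    then have "z \<in> A 0" unfolding K0_def by blast
    then have "fst z \<in> {0..1}" by auto
    moreover have "z = (fst z, f (fst z))" using f(2)[OF z] by simp
    ultimately show "z \<in> {(x, f x) | x. x \<in> {0..1}}" by blast
  qed
  with f(1) show ?thesis by (rule that)
qed

lemma A_measurable: "A n \<in> sets borel"
  by (rule borel_closed[OF closed_A])

text \<open>By the previous estimate, each vertical slice of \<open>A n\<close> has length at most \<open>16 / M\<^sup>n\<close>.\<close>

lemma emeasure_A_le: "emeasure lborel (A n) \<le> ennreal (16 / M ^ n)"
proof -
  have meas: "A n \<in> sets (lborel \<Otimes>\<^sub>M lborel)"
    using A_measurable by (simp only: lborel_prod sets_lborel)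
  have slice: "emeasure lborel (Pair x -` A n) \<le> ennreal (16 / M ^ n) * indicator {0..1} x" for x
  proof (cases "Pair x -` A n = {}")
    case False
    then obtain y where y: "(x, y) \<in> A n" by blast
    have "Pair x -` A n \<subseteq> {y - 8 / M ^ n .. y + 8 / M ^ n}"
    proof
      fix y' assume "y' \<in> Pair x -` A n"
      then have "\<bar>y - y'\<bar> \<le> 8 / M ^ n"
        using A_holder[OF y, of "(x, y')"] \<alpha>_pos M_ge_5 by simp
      then show "y' \<in> {y - 8 / M ^ n .. y + 8 / M ^ n}" by (auto simp: abs_le_iff)
    qed
    then have "emeasure lborel (Pair x -` A n) \<le> emeasure lborel {y - 8 / M ^ n .. y + 8 / M ^ n}"
      by (intro emeasure_mono) auto
    also have "\<dots> = ennreal (16 / M ^ n)" using M_ge_5 by simp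
    finally show ?thesis using y A_subset_A0[of n] by auto
  qed auto
  have "emeasure (lborel \<Otimes>\<^sub>M lborel) (A n) = (\<integral>\<^sup>+x. emeasure lborel (Pair x -` A n) \<partial>lborel)"
    by (rule lborel.emeasure_pair_measure_alt[OF meas])
  also have "\<dots> \<le> (\<integral>\<^sup>+x. ennreal (16 / M ^ n) * indicator {0..1} (x::real) \<partial>lborel)"
    by (rule nn_integral_mono) (rule slice)
  also have "\<dots> = ennreal (16 / M ^ n)"
    by (simp add: nn_integral_cmult)
  finally show ?thesis by (simp add: lborel_prod)
qed

section \<open>Smooth cutoff functions\<close>

text \<open>A smooth function that vanishes near \<open>K0\<close> and is \<open>1\<close> off \<open>A n\<close>. In the initial rectangle, the constants
  are chosen so that it vanishes on a box which still contains the first generation.\<close>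

primrec cutoff :: "nat \<Rightarrow> real \<times> real \<Rightarrow> real" where
  "cutoff 0 = (\<lambda>z. 1 - plateau (4 * fst z + (-2)) * plateau (1 / 2 * snd z + 0))"
| "cutoff (Suc n) = (\<lambda>z. \<Prod>i<N. cutoff n (P i z))"

text \<open>An open neighbourhood of \<open>K0\<close> on which the cutoff function vanishes.\<close>

primrec cutoff_nbhd :: "nat \<Rightarrow> (real \<times> real) set" where
  "cutoff_nbhd 0 = {1 / 8 <..< 7 / 8} \<times> {-3 <..< 3}"
| "cutoff_nbhd (Suc n) = (\<Union>i<N. P i -` cutoff_nbhd n)"

lemma times_cont_diff_cutoff: "times_cont_diff k (cutoff n)"
proof (induction n)
  case 0
  show ?case unfolding cutoff.simps
    by (intro times_cont_diff_diff times_cont_diff_const times_cont_diff_mult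
        times_cont_diff_compose_fst times_cont_diff_compose_snd times_cont_diff_real_affine[of k plateau]
        times_cont_diff_plateau)
next
  case (Suc n)
  then show ?case unfolding cutoff.simps
    by (intro times_cont_diff_prod times_cont_diff_compose_affine[OF has_derivative_P])
qed

lemma open_cutoff_nbhd: "open (cutoff_nbhd n)"
proof (induction n)
  case 0
  show ?case by (simp add: open_Times)
next
  case (Suc n)
  then show ?case by (auto intro!: open_vimage continuous_on_P)
qed

lemma A_Suc_subset_cutoff_nbhd: "A (Suc n) \<subseteq> cutoff_nbhd n"
proof (induction n)
  case 0
  show ?case
  proof
    fix z assume "z \<in> A (Suc 0)"
    then obtain i where "i < N" "P i z \<in> A 0" by auto
    from P_in_A0D[OF this(2,1)] show "z \<in> cutoff_nbhd 0" by (cases z) auto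
  qed
next
  case (Suc n)
  have "P i z \<in> cutoff_nbhd n" if "P i z \<in> A (Suc n)" for i z
    using that Suc by blast
  then show ?case unfolding A.simps(2)[of "Suc n"] cutoff_nbhd.simps(2) by blast
qed

lemma K0_subset_cutoff_nbhd: "K0 \<subseteq> cutoff_nbhd n"
  using A_Suc_subset_cutoff_nbhd unfolding K0_def by blast

lemma cutoff_eq_0: "z \<in> cutoff_nbhd n \<Longrightarrow> cutoff n z = 0"
proof (induction n arbitrary: z)
  case 0
  then have "plateau (4 * fst z + (-2)) = 1" "plateau (1 / 2 * snd z + 0) = 1"
    by (auto intro!: plateau_eq_1 simp: mem_Times_iff abs_if)
  then show ?case by simp
next
  case (Suc n)
  then obtain i where "i < N" "P i z \<in> cutoff_nbhd n" by auto
  from Suc.IH[OF this(2)] \<open>i < N\<close> show ?case by auto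
qed

lemma cutoff_eq_1: "z \<notin> A n \<Longrightarrow> cutoff n z = 1"
proof (induction n arbitrary: z)
  case 0
  then have "fst z < 0 \<or> fst z > 1 \<or> \<bar>snd z\<bar> > 4"
    by (cases z) auto
  then have "plateau (4 * fst z + (-2)) = 0 \<or> plateau (1 / 2 * snd z + 0) = 0"
    using plateau_eq_0[of "4 * fst z + (-2)"] plateau_eq_0[of "1 / 2 * snd z + 0"] by auto
  then show ?case by auto
next
  case (Suc n)
  then show ?case by auto
qed

lemma cutoff_bounds: "0 \<le> cutoff n z" "cutoff n z \<le> 1"
proof (induction n arbitrary: z)
  case 0
  case 1 then show ?case using mult_le_one[OF plateau_bounds(2) plateau_bounds(1) plateau_bounds(2)] by simp
  case 2 then show ?case using plateau_bounds by simp
next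
  case (Suc n)
  case 1 then show ?case using Suc unfolding cutoff.simps by (intro prod_nonneg) blast
  case 2 then show ?case using Suc unfolding cutoff.simps by (intro prod_le_1) blast
qed

lemma cutoff_tendsto:
  assumes "z \<notin> K0"
  shows "(\<lambda>n. cutoff n z) \<longlonglongrightarrow> 1"
proof -
  from assms obtain m where "z \<notin> A m" by (auto simp: K0_def)
  then have "cutoff n z = 1" if "n \<ge> m" for n
    using that A_antimono cutoff_eq_1 by blast
  then show ?thesis by (intro tendsto_eventually eventually_sequentiallyI[of m])
qed

end

section \<open>The self-affine function\<close>

text \<open>The analytic data: weights \<open>c i\<close> with derivatives \<open>c' i\<close>, bounded by \<open>\<kappa>\<close> and \<open>L\<close>. The refinement
  identity says that the profile \<open>plateau\<close> at the right of the initial rectangle is reproduced by the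
  copies. The condition \<open>\<gamma> powr p < M\<close> balances the growth \<open>\<gamma>\<^sup>n\<close> of the vertical derivative
  against the measure of \<open>A n\<close>.\<close>

locale self_affine_function = self_affine_rectangles +
  fixes c c' :: "nat \<Rightarrow> real \<Rightarrow> real" and \<kappa> L \<gamma> p :: real
  assumes \<kappa>_pos: "0 < \<kappa>" and \<kappa>_le: "\<kappa> \<le> 1 / 2"
    and DERIV_c: "i < N \<Longrightarrow> (c i has_field_derivative c' i y) (at y)"
    and c_bound: "i < N \<Longrightarrow> \<bar>c i y\<bar> \<le> \<kappa>"
    and c'_bound: "i < N \<Longrightarrow> \<bar>c' i y\<bar> \<le> L"
    and deriv_plateau_bound: "\<bar>partial_deriv 1 plateau y\<bar> \<le> L"
    and c_zero: "i < N \<Longrightarrow> \<bar>y\<bar> \<ge> 2 \<Longrightarrow> c i y = 0"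
    and refinement: "(\<Sum>i<N. c i y * plateau (M * y - j i)) = plateau y"
    and \<gamma>_ge_2: "2 \<le> \<gamma>" and \<gamma>_ge: "M * \<kappa> \<le> \<gamma>"
    and p_gt_1: "1 < p" and \<gamma>_powr_less: "\<gamma> powr p < M"
begin

text \<open>The approximations: \<open>U 0\<close> increases linearly in \<open>x\<close> from \<open>0\<close> to \<open>plateau y\<close>, and each
  generation replaces the increase by increases across the columns.\<close>

primrec U :: "nat \<Rightarrow> real \<times> real \<Rightarrow> real" where
  "U 0 = (\<lambda>z. max 0 (min 1 (fst z)) * plateau (snd z))"
| "U (Suc n) = (\<lambda>z. \<Sum>i<N. c i (snd z) * U n (P i z))"

lemma continuous_on_c: "i < N \<Longrightarrow> continuous_on S (c i)"
  using DERIV_c by (simp add: continuous_at_imp_continuous_on DERIV_isCont[OF DERIV_c])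

lemma continuous_on_U: "continuous_on UNIV (U n)"
proof (induction n)
  case 0
  show ?case unfolding U.simps
    by (intro continuous_intros continuous_on_compose2[OF continuous_on_plateau[of UNIV]]) auto
next
  case (Suc n)
  show ?case unfolding U.simps
    by (intro continuous_intros continuous_on_compose2[OF continuous_on_c[of _ UNIV]]
        continuous_on_compose2[OF Suc continuous_on_P]) auto
qed

lemma U_left: "fst z \<le> 0 \<Longrightarrow> U n z = 0"
proof (induction n arbitrary: z)
  case (Suc n)
  have "U n (P i z) = 0" if "i < N" for i
  proof (rule Suc.IH)
    show "fst (P i z) \<le> 0"
      using Suc.prems a_lower[OF that] w_pos by (simp add: divide_le_0_iff)
  qed
  then show ?case by simp
qed simp

lemma U_right: "1 \<le> fst z \<Longrightarrow> U n z = plateau (snd z)"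
proof (induction n arbitrary: z)
  case (Suc n)
  have "U n (P i z) = plateau (M * snd z - j i)" if "i < N" for i
  proof -
    have "1 \<le> fst (P i z)"
      using Suc.prems a_upper[OF that] w_pos by (simp add: le_divide_eq)
    from Suc.IH[OF this] show ?thesis by simp
  qed
  then have "U (Suc n) z = (\<Sum>i<N. c i (snd z) * plateau (M * snd z - j i))" by simp
  also have "\<dots> = plateau (snd z)" by (rule refinement)
  finally show ?case .
qed simp

lemma U_eq_off_A: "z \<notin> A n \<Longrightarrow> U (Suc n) z = U n z"
proof (induction n arbitrary: z)
  case 0
  then consider "fst z \<le> 0" | "1 \<le> fst z" | "\<bar>snd z\<bar> \<ge> 4" by (cases z) fastforce
  then show ?case
  proof cases
    case 1
    then show ?thesis by (simp only: U_left)
  next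
    case 2
    then show ?thesis by (simp only: U_right)
  next
    case 3
    then show ?thesis by (simp add: c_zero plateau_eq_0)
  qed
next
  case (Suc n)
  have "U (Suc n) (P i z) = U n (P i z)" if "i < N" for i
    using Suc.prems that by (intro Suc.IH) auto
  then show ?case unfolding U.simps(2)[of "Suc n"] U.simps(2)[of n] by (intro sum.cong) auto
qed

lemma U_eq_outside: "z \<notin> A m \<Longrightarrow> m \<le> n \<Longrightarrow> U n z = U m z"
proof (induction "n - m" arbitrary: n)
  case (Suc d)
  then obtain l where l: "n = Suc l" "d = l - m" "m \<le> l" by (cases n) auto
  then have "z \<notin> A l" using Suc.prems A_antimono by blast
  then have "U n z = U l z" unfolding l(1) by (rule U_eq_off_A)
  also have "\<dots> = U m z" using l Suc.prems by (intro Suc.hyps(1))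
  finally show ?case .
qed simp

lemma U_step_bound: "\<bar>U (Suc n) z - U n z\<bar> \<le> (real N + 1) * \<kappa> ^ n"
proof (induction n arbitrary: z)
  case 0
  have U0: "\<bar>U 0 z\<bar> \<le> 1" for z
    using plateau_bounds[of "snd z"] by (auto simp: abs_mult intro!: mult_le_one)
  have "\<bar>U (Suc 0) z\<bar> \<le> (\<Sum>i<N. \<bar>c i (snd z) * U 0 (P i z)\<bar>)"
    by (simp only: U.simps(2) sum_abs)
  also have "\<dots> \<le> (\<Sum>i<N. 1)"
  proof (rule sum_mono)
    fix i assume "i \<in> {..<N}"
    then have "\<bar>c i (snd z)\<bar> \<le> 1" using c_bound[of i "snd z"] \<kappa>_le by auto
    with U0[of "P i z"] show "\<bar>c i (snd z) * U 0 (P i z)\<bar> \<le> 1"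
      unfolding abs_mult by (intro mult_le_one) auto
  qed
  finally show ?case using U0[of z] by (simp del: U.simps)
next
  case (Suc n)
  have "U (Suc (Suc n)) z - U (Suc n) z = (\<Sum>i<N. c i (snd z) * (U (Suc n) (P i z) - U n (P i z)))"
    unfolding U.simps(2)[of "Suc n"] U.simps(2)[of n]
    by (simp only: sum_subtractf[symmetric] right_diff_distrib)
  also have "\<bar>\<dots>\<bar> \<le> (real N + 1) * \<kappa> ^ Suc n"
  proof (rule sum_single_column[of z])
    fix i assume i: "i < N"
    show "c i (snd z) * (U (Suc n) (P i z) - U n (P i z)) = 0"
      if "\<not> (0 \<le> fst (P i z) \<and> fst (P i z) \<le> 1)"
    proof -
      have "P i z \<notin> A n" using that subsetD[OF A_subset_A0, of "P i z" n] by (auto simp: mem_Times_iff)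
      then have "U (Suc n) (P i z) = U n (P i z)" by (rule U_eq_off_A)
      then show ?thesis by (simp only: diff_self mult_zero_right)
    qed
    have "\<bar>c i (snd z) * (U (Suc n) (P i z) - U n (P i z))\<bar> \<le> \<kappa> * ((real N + 1) * \<kappa> ^ n)"
      unfolding abs_mult using \<kappa>_pos by (intro mult_mono c_bound[OF i] Suc.IH) auto
    then show "\<bar>c i (snd z) * (U (Suc n) (P i z) - U n (P i z))\<bar> \<le> (real N + 1) * \<kappa> ^ Suc n"
      by (simp only: power_Suc mult_ac)
  qed (use \<kappa>_pos in simp)
  finally show ?case .
qed

text \<open>The limit of the approximations, written as a telescoping series.\<close>

definition u :: "real \<times> real \<Rightarrow> real" where
  "u z = U 0 z + (\<Sum>n. U (Suc n) z - U n z)"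

lemma summable_step_bound: "summable (\<lambda>n. (real N + 1) * \<kappa> ^ n)"
  using \<kappa>_pos \<kappa>_le by (intro summable_mult summable_geometric) auto

lemma uniform_limit_U: "uniform_limit UNIV U u sequentially"
proof -
  have "uniform_limit UNIV (\<lambda>n z. \<Sum>i<n. U (Suc i) z - U i z) (\<lambda>z. \<Sum>i. U (Suc i) z - U i z) sequentially"
    using U_step_bound by (intro Weierstrass_m_test_ev[OF _ summable_step_bound] always_eventually) auto
  then have "uniform_limit UNIV (\<lambda>n z. U 0 z + (\<Sum>i<n. U (Suc i) z - U i z))
      (\<lambda>z. U 0 z + (\<Sum>i. U (Suc i) z - U i z)) sequentially"
    by (intro uniform_limit_add uniform_limit_const)
  moreover have "(\<lambda>z. U 0 z + (\<Sum>i<n. U (Suc i) z - U i z)) = U n" for n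
    by (subst sum_lessThan_telescope) (rule ext, simp)
  ultimately show ?thesis by (simp only: u_def[abs_def])
qed

lemma U_tendsto_u: "(\<lambda>n. U n z) \<longlonglongrightarrow> u z"
  using uniform_limit_U by (rule tendsto_uniform_limitI) simp

lemma continuous_on_u: "continuous_on UNIV u"
  by (rule uniform_limit_theorem[OF _ uniform_limit_U]) (auto simp: continuous_on_U simp del: U.simps)

lemma u_eq_U: "z \<notin> A n \<Longrightarrow> u z = U n z"
proof (rule LIMSEQ_unique[OF U_tendsto_u])
  assume "z \<notin> A n"
  then have "U m z = U n z" if "n \<le> m" for m using that by (rule U_eq_outside)
  then show "(\<lambda>m. U m z) \<longlonglongrightarrow> U n z"
    by (intro tendsto_eventually eventually_sequentiallyI[of n])
qed

lemma u_left: "fst z \<le> 0 \<Longrightarrow> u z = 0"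
  using LIMSEQ_unique[OF U_tendsto_u[of z], of 0] U_left[of z] by simp

lemma u_right: "1 \<le> fst z \<Longrightarrow> u z = plateau (snd z)"
  using LIMSEQ_unique[OF U_tendsto_u[of z], of "plateau (snd z)"] U_right[of z] by simp

lemma u_far: "\<bar>snd z\<bar> > 4 \<Longrightarrow> u z = 0"
proof -
  assume z: "\<bar>snd z\<bar> > 4"
  then have "z \<notin> A 0" by (cases z) auto
  with u_eq_U[of z 0] z show ?thesis by (simp add: plateau_eq_0)
qed

lemma U_bounded: obtains B where "0 \<le> B" "\<And>n z. \<bar>U n z\<bar> \<le> B"
proof -
  have U0: "\<bar>U 0 z\<bar> \<le> 1" for z
    using plateau_bounds[of "snd z"] by (auto simp: abs_mult intro!: mult_le_one)
  define S where "S = (\<Sum>n. (real N + 1) * \<kappa> ^ n)"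
  have "\<bar>U n z\<bar> \<le> 1 + S" for n z
  proof -
    have "\<bar>U n z - U 0 z\<bar> = \<bar>\<Sum>i<n. U (Suc i) z - U i z\<bar>"
      by (subst sum_lessThan_telescope) simp
    also have "\<dots> \<le> (\<Sum>i<n. (real N + 1) * \<kappa> ^ i)"
      by (rule order_trans[OF sum_abs]) (intro sum_mono U_step_bound)
    also have "\<dots> \<le> S"
      unfolding S_def using \<kappa>_pos by (intro sum_le_suminf summable_step_bound) auto
    finally show ?thesis using U0[of z] by linarith
  qed
  moreover have "0 \<le> 1 + S" using calculation[of 0 "(0, 0)"] abs_ge_zero by (rule order_trans[rotated])
  ultimately show ?thesis using that by blast
qed

text \<open>The derivative of \<open>U n\<close> in \<open>y\<close>.\<close>

primrec dU :: "nat \<Rightarrow> real \<times> real \<Rightarrow> real" where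
  "dU 0 = (\<lambda>z. max 0 (min 1 (fst z)) * partial_deriv 1 plateau (snd z))"
| "dU (Suc n) = (\<lambda>z. \<Sum>i<N. c' i (snd z) * U n (P i z) + c i (snd z) * (M * dU n (P i z)))"

lemma DERIV_U_snd: "((\<lambda>y. U n (x, y)) has_field_derivative dU n (x, y)) (at y)"
proof (induction n arbitrary: x y)
  case 0
  show ?case by (auto intro!: derivative_eq_intros DERIV_plateau)
next
  case (Suc n)
  have "((\<lambda>y. c i y * U n (P i (x, y))) has_field_derivative
      c' i y * U n (P i (x, y)) + c i y * (M * dU n (P i (x, y)))) (at y)" if "i < N" for i
  proof -
    have "((\<lambda>y. M * y - j i) has_field_derivative M) (at y)"
      by (auto intro!: derivative_eq_intros)
    from DERIV_chain2[OF Suc[of "(x - a i) / w"] this]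
    have "((\<lambda>y. U n (P i (x, y))) has_field_derivative dU n (P i (x, y)) * M) (at y)"
      by (simp add: P_def)
    from DERIV_mult[OF DERIV_c[OF that] this] show ?thesis by (simp add: algebra_simps)
  qed
  then have "((\<lambda>y. \<Sum>i<N. c i y * U n (P i (x, y))) has_field_derivative
      (\<Sum>i<N. c' i y * U n (P i (x, y)) + c i y * (M * dU n (P i (x, y))))) (at y)"
    by (intro DERIV_sum) auto
  then show ?case by simp
qed

lemma dU_bound_outside:
  assumes "\<not> (0 \<le> fst z \<and> fst z \<le> 1)"
  shows "\<bar>dU n z\<bar> \<le> L"
proof -
  obtain x y where z: "z = (x, y)" by (cases z)
  have L: "0 \<le> L" using deriv_plateau_bound[of 0] by linarith
  show ?thesis
  proof (cases "x \<le> 0")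
    case True
    then have "(\<lambda>y. U n (x, y)) = (\<lambda>y. 0)" by (simp add: U_left)
    with DERIV_U_snd[of n x y] have "dU n z = 0"
      using DERIV_unique[OF _ DERIV_const] by (metis z)
    then show ?thesis using L by simp
  next
    case False
    then have "(\<lambda>y. U n (x, y)) = plateau" using assms z by (simp add: U_right fun_eq_iff)
    with DERIV_U_snd[of n x y] have "dU n z = partial_deriv 1 plateau y"
      using DERIV_unique[OF _ DERIV_plateau] by (metis z)
    then show ?thesis using deriv_plateau_bound by simp
  qed
qed

text \<open>The derivative of \<open>U n\<close> obeys a recursion \<open>D\<^sub>n\<^sub>+\<^sub>1 \<le> F + \<gamma> D\<^sub>n\<close>. All columns but one contribute
  only to the constant \<open>F\<close>, because left and right of a rectangle \<open>U n\<close> does not depend on \<open>n\<close>.\<close>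

lemma dU_bounded: obtains E where "0 \<le> E" "\<And>n z. \<bar>dU n z\<bar> \<le> E * \<gamma> ^ n"
proof -
  obtain B where B: "0 \<le> B" "\<And>n z. \<bar>U n z\<bar> \<le> B" by (blast intro: U_bounded)
  have L: "0 \<le> L" using deriv_plateau_bound[of 0] by linarith
  define F where "F = real N * (L * B + \<kappa> * (M * L))"
  have F: "0 \<le> F" using L B \<kappa>_pos M_ge_5 by (simp add: F_def)
  have *: "\<bar>dU n z\<bar> \<le> (L + F) * \<gamma> ^ n - F" for n z
  proof (induction n arbitrary: z)
    case 0
    have "\<bar>dU 0 z\<bar> = \<bar>max 0 (min 1 (fst z))\<bar> * \<bar>partial_deriv 1 plateau (snd z)\<bar>"
      by (simp add: abs_mult)
    also have "\<dots> \<le> 1 * L" by (intro mult_mono deriv_plateau_bound) auto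
    finally show ?case by simp
  next
    case (Suc n)
    define D where "D = (L + F) * \<gamma> ^ n - F"
    have D: "\<bar>dU n z\<bar> \<le> D" for z unfolding D_def by (rule Suc.IH)
    then have D0: "0 \<le> D" using abs_ge_zero order_trans by blast
    \<comment> \<open>Only one column contributes a derivative of the previous generation that may be large.\<close>
    define q where "q i = (if 0 \<le> fst (P i z) \<and> fst (P i z) \<le> 1 then c i (snd z) * (M * dU n (P i z)) else 0)" for i
    define r where "r i = c' i (snd z) * U n (P i z) +
      (if 0 \<le> fst (P i z) \<and> fst (P i z) \<le> 1 then 0 else c i (snd z) * (M * dU n (P i z)))" for i
    have "dU (Suc n) z = (\<Sum>i<N. q i + r i)"
      unfolding dU.simps by (intro sum.cong) (auto simp: q_def r_def)
    then have split: "dU (Suc n) z = (\<Sum>i<N. q i) + (\<Sum>i<N. r i)" by (simp only: sum.distrib)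
    have "\<bar>\<Sum>i<N. q i\<bar> \<le> \<kappa> * (M * D)"
    proof (rule sum_single_column[of z])
      fix i assume i: "i < N"
      have "\<bar>c i (snd z) * (M * dU n (P i z))\<bar> \<le> \<kappa> * (M * D)"
        unfolding abs_mult using c_bound[OF i] D \<kappa>_pos M_ge_5 by (intro mult_mono) auto
      then show "\<bar>q i\<bar> \<le> \<kappa> * (M * D)"
        using \<kappa>_pos M_ge_5 D0 by (auto simp: q_def)
    qed (use \<kappa>_pos M_ge_5 D0 in \<open>auto simp: q_def\<close>)
    also have "\<kappa> * (M * D) = (M * \<kappa>) * D" by simp
    also have "\<dots> \<le> \<gamma> * D" using \<gamma>_ge D0 by (rule mult_right_mono)
    finally have q: "\<bar>\<Sum>i<N. q i\<bar> \<le> \<gamma> * D" .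
    have "\<bar>r i\<bar> \<le> L * B + \<kappa> * (M * L)" if i: "i < N" for i
    proof -
      have "\<bar>c' i (snd z) * U n (P i z)\<bar> \<le> L * B"
        unfolding abs_mult using c'_bound[OF i] B L by (intro mult_mono) auto
      moreover have "\<bar>if 0 \<le> fst (P i z) \<and> fst (P i z) \<le> 1 then 0 else c i (snd z) * (M * dU n (P i z))\<bar>
          \<le> \<kappa> * (M * L)"
      proof (cases "0 \<le> fst (P i z) \<and> fst (P i z) \<le> 1")
        case True
        then show ?thesis using \<kappa>_pos M_ge_5 L by simp
      next
        case False
        have "\<bar>c i (snd z) * (M * dU n (P i z))\<bar> \<le> \<kappa> * (M * L)"
          unfolding abs_mult using c_bound[OF i] dU_bound_outside[OF False] \<kappa>_pos M_ge_5
          by (intro mult_mono) auto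
        then show ?thesis using False by (simp only: if_False)
      qed
      ultimately show ?thesis unfolding r_def by linarith
    qed
    then have "\<bar>\<Sum>i<N. r i\<bar> \<le> (\<Sum>i<N. L * B + \<kappa> * (M * L))"
      by (intro order_trans[OF sum_abs] sum_mono) auto
    then have "\<bar>\<Sum>i<N. r i\<bar> \<le> F" by (simp add: F_def)
    with q split have "\<bar>dU (Suc n) z\<bar> \<le> F + \<gamma> * D" by linarith
    also have "\<dots> = (L + F) * \<gamma> ^ Suc n - F + (2 - \<gamma>) * F" by (simp add: D_def algebra_simps)
    also have "\<dots> \<le> (L + F) * \<gamma> ^ Suc n - F" using \<gamma>_ge_2 F by (simp add: mult_nonpos_nonneg)
    finally show ?case .
  qed
  have "\<bar>dU n z\<bar> \<le> (L + F) * \<gamma> ^ n" for n z using *[of n z] F by linarith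
  moreover have "0 \<le> L + F" using L F by simp
  ultimately show ?thesis using that by blast
qed

lemma DERIV_U_fst:
  "(x, y) \<notin> A n \<Longrightarrow> ((\<lambda>x. U n (x, y)) has_field_derivative 0) (at x)"
proof (induction n arbitrary: x y)
  case 0
  then consider "x < 0" | "1 < x" | "\<bar>y\<bar> > 4" by fastforce
  then show ?case
  proof cases
    case 1
    have "((\<lambda>x. 0) has_field_derivative 0) (at x)" by simp
    then show ?thesis
      by (rule has_field_derivative_transform_within_open[where S = "{..<0}"]) (use 1 in auto)
  next
    case 2
    have "((\<lambda>x. plateau y) has_field_derivative 0) (at x)" by simp
    then show ?thesis
      by (rule has_field_derivative_transform_within_open[where S = "{1<..}"]) (use 2 in auto)
  next
    case 3
    then show ?thesis by (simp add: plateau_eq_0)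
  qed
next
  case (Suc n)
  have "((\<lambda>x. c i y * U n (P i (x, y))) has_field_derivative 0) (at x)" if "i < N" for i
  proof -
    have d: "((\<lambda>x. (x - a i) / w) has_field_derivative 1 / w) (at x)"
      using w_pos by (auto intro!: derivative_eq_intros)
    have "((x - a i) / w, M * y - j i) \<notin> A n" using Suc.prems that by (auto simp: P_def)
    from DERIV_chain2[OF Suc.IH[OF this] d]
    have "((\<lambda>x. U n (P i (x, y))) has_field_derivative 0) (at x)" by (simp add: P_def)
    from DERIV_cmult[OF this, of "c i y"] show ?thesis by simp
  qed
  then have "((\<lambda>x. \<Sum>i<N. c i y * U n (P i (x, y))) has_field_derivative (\<Sum>i<N. 0)) (at x)"
    by (intro DERIV_sum) auto
  then show ?case by simp
qed

lemma open_slices: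
  "open {x. (x, y) \<notin> A n}" "open {y. (x, y) \<notin> A n}"
proof -
  have "open ((\<lambda>x. (x, y)) -` (- A n))" "open ((\<lambda>y. (x, y)) -` (- A n))"
    using closed_A[of n] by (auto intro!: open_vimage continuous_intros simp del: vimage_Compl)
  then show "open {x. (x, y) \<notin> A n}" "open {y. (x, y) \<notin> A n}"
    by (simp_all add: vimage_def)
qed

lemma DERIV_u_fst:
  assumes "(x, y) \<notin> K0"
  shows "((\<lambda>x. u (x, y)) has_field_derivative 0) (at x)"
proof -
  from assms obtain n where n: "(x, y) \<notin> A n" by (auto simp: K0_def)
  from DERIV_U_fst[OF n] show ?thesis
    by (rule has_field_derivative_transform_within_open[OF _ open_slices(1)[of y n]])
      (use n u_eq_U in auto)
qed

lemma DERIV_u_snd: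
  assumes "(x, y) \<notin> A n"
  shows "((\<lambda>y. u (x, y)) has_field_derivative dU n (x, y)) (at y)"
  by (rule has_field_derivative_transform_within_open[OF DERIV_U_snd open_slices(2)[of x n]])
    (use assms u_eq_U in auto)

text \<open>The derivative of \<open>u\<close> in \<open>y\<close>. The value \<open>0\<close> on the null set \<open>K0\<close>, where \<open>u\<close> need not be
  differentiable, is arbitrary but makes the bounds below hold everywhere.\<close>

definition uy :: "real \<times> real \<Rightarrow> real" where
  "uy z = (if z \<in> K0 then 0 else deriv (\<lambda>y. u (fst z, y)) (snd z))"

lemma uy_eq_dU: "z \<notin> A n \<Longrightarrow> uy z = dU n z"
proof -
  assume z: "z \<notin> A n"
  then have "deriv (\<lambda>y. u (fst z, y)) (snd z) = dU n z"
    using DERIV_imp_deriv[OF DERIV_u_snd[of "fst z" "snd z" n]] by simp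
  moreover have "z \<notin> K0" using z by (auto simp: K0_def)
  ultimately show ?thesis by (simp add: uy_def)
qed

lemma DERIV_u_uy:
  assumes "(x, y) \<notin> K0"
  shows "((\<lambda>y. u (x, y)) has_field_derivative uy (x, y)) (at y)"
proof -
  from assms obtain n where n: "(x, y) \<notin> A n" by (auto simp: K0_def)
  from DERIV_u_snd[OF n] uy_eq_dU[OF n] show ?thesis by simp
qed

lemma borel_measurable_uy: "uy \<in> borel_measurable borel"
proof -
  let ?q = "\<lambda>i z. (u (fst z, snd z + inverse (real (Suc i))) - u z) / inverse (real (Suc i))"
  have uy: "uy = (\<lambda>z. if z \<in> K0 then 0 else lim (\<lambda>i. ?q i z))"
  proof
    fix z
    show "uy z = (if z \<in> K0 then 0 else lim (\<lambda>i. ?q i z))"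
    proof (cases "z \<in> K0")
      case False
      have f: "filterlim (\<lambda>i. inverse (real (Suc i))) (at 0) sequentially"
        unfolding filterlim_at using LIMSEQ_inverse_real_of_nat by (auto intro!: always_eventually)
      have "((\<lambda>y. u (fst z, y)) has_field_derivative uy z) (at (snd z))"
        using DERIV_u_uy[of "fst z" "snd z"] False by simp
      then have "((\<lambda>h. (u (fst z, snd z + h) - u (fst z, snd z)) / h) \<longlongrightarrow> uy z) (at 0)"
        by (rule DERIV_D)
      from filterlim_compose[OF this f] have "(\<lambda>i. ?q i z) \<longlonglongrightarrow> uy z" by simp
      then show ?thesis using False by (simp add: limI)
    qed (simp add: uy_def)
  qed
  have "?q i \<in> borel_measurable borel" for i
    by (intro borel_measurable_continuous_onI continuous_intros
        continuous_on_compose2[OF continuous_on_u]) auto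
  then have "(\<lambda>z. lim (\<lambda>i. ?q i z)) \<in> borel_measurable borel"
    by (rule borel_measurable_lim_metric)
  moreover have "K0 \<in> sets borel" using closed_K0 by (rule borel_closed)
  ultimately show ?thesis
    unfolding uy by (intro measurable_If_set) auto
qed

text \<open>A point off \<open>K0\<close> that is in \<open>A l\<close> but not in \<open>A (l + 1)\<close> satisfies
  \<open>\<bar>uy z\<bar> \<le> E * \<gamma> ^ (l + 1)\<close>. So the integral is bounded by a geometric series of ratio \<open>\<gamma> powr p / M\<close>.\<close>

lemma integrable_powr_uy:
  "integrable lborel (\<lambda>z. \<bar>plateau (fst z) * uy z\<bar> powr p)"
proof -
  obtain E where E: "0 \<le> E" "\<And>n z. \<bar>dU n z\<bar> \<le> E * \<gamma> ^ n" by (blast intro: dU_bounded)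
  let ?box = "cbox (-2, -4) (2, 4) :: (real \<times> real) set"
  let ?G = "\<lambda>n z. ennreal ((E * \<gamma> ^ Suc n) powr p) * indicator (A n) z"
  have bound: "ennreal (\<bar>plateau (fst z) * uy z\<bar> powr p)
      \<le> ennreal (E powr p) * indicator ?box z + (\<Sum>n. ?G n z)" for z
  proof (cases "z \<in> K0")
    case False
    then have ex: "\<exists>n. z \<notin> A n" by (auto simp: K0_def)
    \<comment> \<open>The first generation that misses \<open>z\<close> gives the best bound on the derivative.\<close>
    define m where "m = (LEAST n. z \<notin> A n)"
    have m: "z \<notin> A m" unfolding m_def using ex by (rule LeastI_ex)
    have "\<bar>plateau (fst z) * uy z\<bar> \<le> 1 * \<bar>dU m z\<bar>"
      unfolding uy_eq_dU[OF m] abs_mult using plateau_bounds[of "fst z"] by (intro mult_right_mono) auto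
    also have "\<dots> \<le> E * \<gamma> ^ m" using E(2)[of m z] by simp
    finally have le: "\<bar>plateau (fst z) * uy z\<bar> powr p \<le> (E * \<gamma> ^ m) powr p"
      using p_gt_1 by (intro powr_mono2) auto
    show ?thesis
    proof (cases m)
      case 0
      show ?thesis
      proof (cases "z \<in> ?box")
        case True
        have "ennreal (\<bar>plateau (fst z) * uy z\<bar> powr p) \<le> ennreal (E powr p) * indicator ?box z"
          using True le 0 by (simp add: ennreal_leI)
        also have "\<dots> \<le> ennreal (E powr p) * indicator ?box z + (\<Sum>n. ?G n z)" by simp
        finally show ?thesis .
      next
        case False
        then have "\<bar>fst z\<bar> \<ge> 2 \<or> \<bar>snd z\<bar> \<ge> 4" by (cases z) (auto simp: cbox_Pair_eq abs_if)
        then have "plateau (fst z) * uy z = 0"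
          using uy_eq_dU[OF m] 0 by (auto simp: plateau_eq_0 deriv_plateau_eq_0)
        then have "ennreal (\<bar>plateau (fst z) * uy z\<bar> powr p) = 0"
          using p_gt_1 by (simp only: abs_zero powr_zero_eq_one ennreal_0 powr_def) simp
        then show ?thesis by (simp only: zero_le)
      qed
    next
      case (Suc l)
      have "z \<in> A l" using not_less_Least[of l "\<lambda>n. z \<notin> A n"] Suc by (auto simp: m_def)
      then have "ennreal (\<bar>plateau (fst z) * uy z\<bar> powr p) \<le> ?G l z"
        using le Suc by (simp add: ennreal_leI)
      also have "\<dots> \<le> (\<Sum>n. ?G n z)"
      proof -
        define f where "f n = ?G n z" for n
        have "sum f {l} \<le> suminf f" by (rule sum_le_suminf) auto
        then have "f l \<le> suminf f" by simp
        then show ?thesis unfolding f_def[abs_def] .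
      qed
      also have "\<dots> \<le> ennreal (E powr p) * indicator ?box z + (\<Sum>n. ?G n z)" by simp
      finally show ?thesis .
    qed
  qed (simp add: uy_def)
  define r where "r = \<gamma> powr p / M"
  have r: "0 \<le> r" "r < 1" using \<gamma>_powr_less M_ge_5 by (auto simp: r_def)
  have "(\<integral>\<^sup>+z. ennreal (\<bar>plateau (fst z) * uy z\<bar> powr p) \<partial>lborel)
      \<le> (\<integral>\<^sup>+z. ennreal (E powr p) * indicator ?box z + (\<Sum>n. ?G n z) \<partial>lborel)"
    by (rule nn_integral_mono) (rule bound)
  also have "\<dots> = (\<integral>\<^sup>+z. ennreal (E powr p) * indicator ?box z \<partial>lborel) + (\<Sum>n. \<integral>\<^sup>+z. ?G n z \<partial>lborel)"
  proof -
    have meas: "?G n \<in> borel_measurable lborel" for n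
      using A_measurable[of n] by (simp del: A.simps)
    have "(\<lambda>z. \<Sum>n. ?G n z) \<in> borel_measurable lborel"
      by (intro borel_measurable_suminf_order meas)
    moreover have "(\<lambda>z. ennreal (E powr p) * indicator ?box z) \<in> borel_measurable lborel" by simp
    ultimately show ?thesis
      by (subst nn_integral_add) (simp_all only: nn_integral_suminf[OF meas])
  qed
  also have "\<dots> \<le> ennreal (E powr p) * emeasure lborel ?box
      + (\<Sum>n. ennreal (16 * (E * \<gamma>) powr p * r ^ n))"
  proof (intro add_mono suminf_le summableI)
    fix n
    have "(\<integral>\<^sup>+z. ?G n z \<partial>lborel) = ennreal ((E * \<gamma> ^ Suc n) powr p) * emeasure lborel (A n)"
      using A_measurable[of n] by (intro nn_integral_cmult_indicator) simp
    also have "\<dots> \<le> ennreal ((E * \<gamma> ^ Suc n) powr p) * ennreal (16 / M ^ n)"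
      by (intro mult_left_mono emeasure_A_le) simp
    also have "\<dots> = ennreal ((E * \<gamma> ^ Suc n) powr p * (16 / M ^ n))"
      using M_ge_5 by (intro ennreal_mult[symmetric]) simp_all
    also have "\<dots> = ennreal (16 * (E * \<gamma>) powr p * r ^ n)"
    proof -
      have "(\<gamma> ^ n) powr p = (\<gamma> powr p) ^ n"
        using \<gamma>_ge_2 by (induction n) (simp_all add: powr_mult)
      then have "(E * \<gamma> ^ Suc n) powr p = (E * \<gamma>) powr p * (\<gamma> powr p) ^ n"
        using E(1) \<gamma>_ge_2 by (simp add: powr_mult mult.assoc)
      then show ?thesis by (simp add: r_def power_divide mult.commute mult.left_commute)
    qed
    finally show "(\<integral>\<^sup>+z. ?G n z \<partial>lborel) \<le> ennreal (16 * (E * \<gamma>) powr p * r ^ n)" .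
  next
    show "(\<integral>\<^sup>+z. ennreal (E powr p) * indicator ?box z \<partial>lborel) \<le> ennreal (E powr p) * emeasure lborel ?box"
      by (subst nn_integral_cmult_indicator) simp_all
  qed
  also have "\<dots> < \<infinity>"
  proof -
    have "summable (\<lambda>n. 16 * (E * \<gamma>) powr p * r ^ n)"
      using r by (intro summable_mult summable_geometric) auto
    then have "(\<Sum>n. ennreal (16 * (E * \<gamma>) powr p * r ^ n)) < \<infinity>"
      using r by (subst suminf_ennreal2) simp_all
    moreover have "emeasure lborel ?box < \<infinity>" by (rule emeasure_lborel_cbox_finite)
    ultimately show ?thesis by (simp add: ennreal_mult_less_top)
  qed
  finally have fin: "(\<integral>\<^sup>+z. ennreal (\<bar>plateau (fst z) * uy z\<bar> powr p) \<partial>lborel) < \<infinity>" .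
  have "(\<lambda>z. plateau (fst z)) \<in> borel_measurable borel"
    by (intro borel_measurable_continuous_onI continuous_on_compose2[OF continuous_on_plateau[of UNIV]]
        continuous_intros) auto
  then have "(\<lambda>z. \<bar>plateau (fst z) * uy z\<bar> powr p) \<in> borel_measurable borel"
    using borel_measurable_uy by (intro powr_real_measurable borel_measurable_abs borel_measurable_times) simp_all
  then show ?thesis
    by (intro integrableI_nonneg fin) simp_all
qed

end

section \<open>Integration on the plane\<close>

lemma borel_measurable_lebesgue:
  fixes f :: "'a::euclidean_space \<Rightarrow> real"
  shows "f \<in> borel_measurable borel \<Longrightarrow> f \<in> borel_measurable lebesgue"
  by (intro measurable_completion) simp

lemma Lp_space_borel:
  fixes f :: "'a::euclidean_space \<Rightarrow> real"
  assumes f: "f \<in> borel_measurable borel" "integrable lborel (\<lambda>x. \<bar>f x\<bar> powr p)"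
    and \<Omega>: "\<Omega> \<in> sets borel"
  shows "f \<in> Lp_space p \<Omega>"
proof -
  have m: "(\<lambda>x. \<bar>f x\<bar> powr p) \<in> borel_measurable lborel" using f(2) by (rule borel_measurable_integrable)
  have \<Omega>': "\<Omega> \<in> sets lebesgue" using \<Omega> by (intro sets_completionI_sets) simp
  have "integrable lebesgue (\<lambda>x. indicator \<Omega> x *\<^sub>R \<bar>f x\<bar> powr p)"
    using f(2) by (intro integrable_mult_indicator \<Omega>') (simp add: integrable_completion[OF m])
  then have "integrable (lebesgue_on \<Omega>) (\<lambda>x. \<bar>f x\<bar> powr p)"
    using \<Omega>' by (subst integrable_restrict_space) simp_all
  moreover have "f \<in> borel_measurable (lebesgue_on \<Omega>)"
    by (rule measurable_restrict_space1[OF borel_measurable_lebesgue[OF f(1)]])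
  ultimately show ?thesis by (simp add: Lp_space_def)
qed

lemma integral_lebesgue_on_conull:
  fixes h :: "'a::euclidean_space \<Rightarrow> real"
  assumes h: "h \<in> borel_measurable borel" and \<Gamma>: "\<Gamma> \<in> null_sets lborel"
  shows "(LINT x|lebesgue_on (UNIV - \<Gamma>). h x) = (LINT x|lborel. h x)"
proof -
  have \<Gamma>': "\<Gamma> \<in> null_sets lebesgue" using \<Gamma> by (rule null_sets_completionI)
  then have \<Omega>: "UNIV - \<Gamma> \<in> sets lebesgue"
    using sets.compl_sets[OF null_setsD2[OF \<Gamma>']] by simp
  have hm: "h \<in> borel_measurable lebesgue" using h by (rule borel_measurable_lebesgue)
  have "(LINT x|lebesgue_on (UNIV - \<Gamma>). h x) = (LINT x|lebesgue. indicator (UNIV - \<Gamma>) x *\<^sub>R h x)"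
    using \<Omega> by (intro integral_restrict_space) simp
  also have "\<dots> = (LINT x|lebesgue. h x)"
  proof (rule integral_cong_AE)
    show "(\<lambda>x. indicator (UNIV - \<Gamma>) x *\<^sub>R h x) \<in> borel_measurable lebesgue"
      using hm \<Omega> by (intro borel_measurable_scaleR borel_measurable_indicator)
    show "AE x in lebesgue. indicator (UNIV - \<Gamma>) x *\<^sub>R h x = h x"
      using AE_not_in[OF \<Gamma>'] by eventually_elim (simp add: indicator_def)
  qed (rule hm)
  also have "\<dots> = (LINT x|lborel. h x)" using h by (intro integral_completion) simp
  finally show ?thesis .
qed

lemma integral_lebesgue_on_UNIV: "integral\<^sup>L (lebesgue_on UNIV) f = integral\<^sup>L lebesgue f"
  by (simp add: lebesgue_on_UNIV_eq)

lemma integrable_continuous_support_compact: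
  fixes h :: "'a::euclidean_space \<Rightarrow> real"
  assumes "continuous_on UNIV h" "compact S" "\<And>z. z \<notin> S \<Longrightarrow> h z = 0"
  shows "integrable lborel h"
proof -
  have "integrable lborel (\<lambda>z. indicator S z *\<^sub>R h z)"
    using assms(1,2) by (intro borel_integrable_compact) (auto intro: continuous_on_subset)
  moreover have "(\<lambda>z. indicator S z *\<^sub>R h z) = h"
    by (rule ext) (simp add: assms(3) split: split_indicator)
  ultimately show ?thesis by simp
qed

lemma test_function_bounded:
  assumes "\<psi> \<in> test_functions \<Omega>"
  obtains C where "0 \<le> C" "\<And>z. \<bar>\<psi> z\<bar> \<le> C"
proof -
  have "compact (closure {z. \<psi> z \<noteq> 0})" using assms unfolding test_functions_def by blast
  then have "bounded (\<psi> ` closure {z. \<psi> z \<noteq> 0})"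
    by (intro compact_imp_bounded compact_continuous_image
        continuous_on_subset[OF test_functions_continuous[OF assms]]) simp_all
  then obtain C where C: "\<forall>x\<in>\<psi> ` closure {z. \<psi> z \<noteq> 0}. norm x \<le> C" unfolding bounded_iff ..
  have "\<bar>\<psi> z\<bar> \<le> max 0 C" for z
  proof (cases "z \<in> closure {z. \<psi> z \<noteq> 0}")
    case True
    then have "norm (\<psi> z) \<le> C" using C by blast
    then show ?thesis by simp
  next
    case False
    then have "\<psi> z = 0" by (rule test_functions_zero)
    then show ?thesis by simp
  qed
  then show ?thesis using that[of "max 0 C"] by simp
qed

text \<open>On the support of the test function, \<open>\<bar>g\<bar> \<le> 1 + \<bar>g\<bar> powr p\<close>.\<close>

lemma integrable_test_function_mult:
  fixes g :: "'a::euclidean_space \<Rightarrow> real"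
  assumes \<psi>: "\<psi> \<in> test_functions \<Omega>"
    and g: "g \<in> borel_measurable lebesgue" "integrable lebesgue (\<lambda>z. \<bar>g z\<bar> powr p)" and "1 \<le> p"
  shows "integrable lebesgue (\<lambda>z. \<psi> z * g z)"
proof -
  obtain C where C: "0 \<le> C" "\<And>z. \<bar>\<psi> z\<bar> \<le> C" using test_function_bounded[OF \<psi>] by blast
  let ?S = "closure {z. \<psi> z \<noteq> 0}"
  have "compact ?S" using \<psi> unfolding test_functions_def by blast
  then have S: "?S \<in> sets lborel" "emeasure lborel ?S < \<infinity>"
    using emeasure_compact_finite[OF \<open>compact ?S\<close>] borel_compact[OF \<open>compact ?S\<close>] by simp_all
  show ?thesis
  proof (rule Bochner_Integration.integrable_bound)
    have "integrable lborel (indicator ?S :: 'a \<Rightarrow> real)"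
      using S by (rule integrable_real_indicator)
    then have "integrable lebesgue (indicator ?S :: 'a \<Rightarrow> real)"
      using borel_measurable_indicator[OF S(1)] by (subst integrable_completion)
    then show "integrable lebesgue (\<lambda>z. C * (indicator ?S z + \<bar>g z\<bar> powr p))"
      using g(2) by (intro integrable_mult_right Bochner_Integration.integrable_add)
    show "(\<lambda>z. \<psi> z * g z) \<in> borel_measurable lebesgue"
      by (rule borel_measurable_times[OF borel_measurable_lebesgue[OF
              borel_measurable_continuous_onI[OF test_functions_continuous[OF \<psi>]]] g(1)])
    have le: "\<bar>\<psi> z * g z\<bar> \<le> C * (indicator ?S z + \<bar>g z\<bar> powr p)" for z
    proof (cases "z \<in> ?S")
      case True
      have "\<bar>g z\<bar> \<le> 1 + \<bar>g z\<bar> powr p"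
      proof (cases "\<bar>g z\<bar> \<le> 1")
        case True
        then show ?thesis using powr_ge_zero[of "\<bar>g z\<bar>" p] by linarith
      next
        case False
        then have "\<bar>g z\<bar> powr 1 \<le> \<bar>g z\<bar> powr p" using \<open>1 \<le> p\<close> by (intro powr_mono) simp_all
        moreover have "\<bar>g z\<bar> powr 1 = \<bar>g z\<bar>" by (rule powr_one) simp
        ultimately show ?thesis by linarith
      qed
      then have "\<bar>\<psi> z\<bar> * \<bar>g z\<bar> \<le> C * (1 + \<bar>g z\<bar> powr p)"
        using C by (intro mult_mono) simp_all
      then show ?thesis using True by (simp add: abs_mult)
    next
      case False
      then have "\<psi> z = 0" by (rule test_functions_zero)
      then show ?thesis using C(1) by simp
    qed
    have "norm (\<psi> z * g z) \<le> norm (C * (indicator ?S z + \<bar>g z\<bar> powr p))" for z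
      using le[of z] unfolding real_norm_def by linarith
    then show "AE z in lebesgue. norm (\<psi> z * g z) \<le> norm (C * (indicator ?S z + \<bar>g z\<bar> powr p))"
      by (intro always_eventually allI)
  qed
qed

text \<open>Fubini's theorem, for a function whose integrals over the vertical lines are known as gauge
  integrals, for instance from the fundamental theorem of calculus.\<close>

lemma integral_eq_integral_slices_snd:
  fixes H :: "real \<times> real \<Rightarrow> real"
  assumes H: "integrable lborel H" and slice: "\<And>x. ((\<lambda>y. H (x, y)) has_integral F x) UNIV"
    and F: "F \<in> borel_measurable lborel"
  shows "(LINT z|lborel. H z) = (LINT x|lborel. F x)"
proof -
  have H': "integrable (lborel \<Otimes>\<^sub>M lborel) H" using H by (simp only: lborel_prod)
  have ae: "AE x in lborel. (LINT y|lborel. H (x, y)) = F x"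
    using lborel_pair.AE_integrable_fst'[OF H']
    by eventually_elim (rule has_integral_unique[OF has_integral_integral_lborel slice])
  have "(LINT z|lborel. H z) = (LINT x|lborel. LINT y|lborel. H (x, y))"
    using lborel_pair.integral_fst'[OF H'] by (simp only: lborel_prod)
  also have "\<dots> = (LINT x|lborel. F x)"
    by (rule integral_cong_AE[OF _ F ae])
      (rule borel_measurable_integrable[OF lborel_pair.integrable_fst'[OF H']])
  finally show ?thesis .
qed

lemma integral_eq_integral_slices_fst:
  fixes H :: "real \<times> real \<Rightarrow> real"
  assumes H: "integrable lborel H" and slice: "\<And>y. ((\<lambda>x. H (x, y)) has_integral F y) UNIV"
    and F: "F \<in> borel_measurable lborel"
  shows "(LINT z|lborel. H z) = (LINT y|lborel. F y)"
proof -
  have H': "integrable (lborel \<Otimes>\<^sub>M lborel) (case_prod (\<lambda>x y. H (x, y)))"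
    using H by (simp only: lborel_prod case_prod_eta)
  have ae: "AE y in lborel. (LINT x|lborel. H (x, y)) = F y"
    using lborel_pair.AE_integrable_snd[OF H']
    by eventually_elim (rule has_integral_unique[OF has_integral_integral_lborel slice])
  have "(LINT z|lborel. H z) = (LINT y|lborel. LINT x|lborel. H (x, y))"
    using lborel_pair.integral_snd[OF H'] by (simp only: lborel_prod case_prod_eta)
  also have "\<dots> = (LINT y|lborel. F y)"
    by (rule integral_cong_AE[OF _ F ae])
      (rule borel_measurable_integrable[OF lborel_pair.integrable_snd[OF H']])
  finally show ?thesis .
qed

lemma has_integral_zero_of_bounded_support:
  fixes h :: "real \<Rightarrow> real"
  assumes S: "finite S" and cont: "continuous_on UNIV h"
    and d: "\<And>t. t \<notin> S \<Longrightarrow> (h has_field_derivative h' t) (at t)"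
    and zero: "0 < R" "\<And>t. R \<le> \<bar>t\<bar> \<Longrightarrow> h t = 0" "\<And>t. R \<le> \<bar>t\<bar> \<Longrightarrow> h' t = 0"
  shows "(h' has_integral 0) UNIV"
proof -
  have "(h' has_integral (h R - h (-R))) {-R..R}"
    by (rule fundamental_theorem_of_calculus_strong[OF S])
      (use zero d cont in \<open>auto simp: has_real_derivative_iff_has_vector_derivative intro: continuous_on_subset\<close>)
  then have "(h' has_integral 0) {-R..R}" using zero by simp
  then show ?thesis
    by (rule has_integral_on_superset) (use zero(3) in auto)
qed

context self_affine_function
begin

section \<open>The exceptional function\<close>

text \<open>The function that is not removable. The factor \<open>plateau\<close> makes the support compact and is \<open>1\<close> on the
  range of abscissae of \<open>K0\<close>.\<close>

definition v :: "real \<times> real \<Rightarrow> real" where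
  "v z = plateau (fst z) * u z"

text \<open>The derivatives of \<open>v\<close> off \<open>K0\<close>; the partial derivative of \<open>u\<close> in \<open>x\<close> vanishes there.\<close>

definition vx :: "real \<times> real \<Rightarrow> real" where
  "vx z = partial_deriv 1 plateau (fst z) * u z"

definition vy :: "real \<times> real \<Rightarrow> real" where
  "vy z = plateau (fst z) * uy z"

lemma continuous_on_v: "continuous_on UNIV v"
  unfolding v_def[abs_def]
  by (intro continuous_on_mult continuous_on_u continuous_on_compose2[OF continuous_on_plateau[of UNIV]]
      continuous_on_fst continuous_on_id) auto

lemma continuous_on_vx: "continuous_on UNIV vx"
  unfolding vx_def[abs_def]
  by (intro continuous_on_mult continuous_on_u continuous_on_compose2[OF continuous_on_deriv_plateau[of UNIV]]
      continuous_on_fst continuous_on_id) auto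

lemma v_support:
  assumes "z \<notin> cbox (-2, -4) (2, 4)"
  shows "v z = 0" "vx z = 0"
proof -
  have "\<bar>fst z\<bar> \<ge> 2 \<or> \<bar>snd z\<bar> > 4" using assms by (cases z) (auto simp: cbox_Pair_eq abs_if)
  then show "v z = 0" "vx z = 0"
    by (auto simp: v_def vx_def plateau_eq_0 deriv_plateau_eq_0 u_far)
qed

lemma integrable_powr_bounded_support:
  assumes "continuous_on UNIV f" "\<And>z. z \<notin> cbox (-2, -4) (2, 4) \<Longrightarrow> f z = 0"
  shows "integrable lborel (\<lambda>z::real \<times> real. \<bar>f z\<bar> powr p)"
proof (rule integrable_continuous_support_compact[OF _ compact_cbox])
  show "continuous_on UNIV (\<lambda>z. \<bar>f z\<bar> powr p)"
    using p_gt_1 assms(1) by (intro continuous_on_powr' continuous_on_rabs continuous_on_const) auto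
  show "\<bar>f z\<bar> powr p = 0" if "z \<notin> cbox (-2, -4) (2, 4)" for z
    using assms(2)[OF that] p_gt_1 by simp
qed

lemmas integrable_powr_v = integrable_powr_bounded_support[OF continuous_on_v v_support(1)]
  and integrable_powr_vx = integrable_powr_bounded_support[OF continuous_on_vx v_support(2)]

lemma borel_measurable_vy: "vy \<in> borel_measurable borel"
proof -
  have "(\<lambda>z. plateau (fst z)) \<in> borel_measurable borel"
    by (intro borel_measurable_continuous_onI continuous_on_compose2[OF continuous_on_plateau[of UNIV]]
        continuous_intros) auto
  then show ?thesis unfolding vy_def[abs_def] using borel_measurable_uy by (rule borel_measurable_times)
qed

lemma integrable_mult_test_function:
  assumes \<psi>: "\<psi> \<in> test_functions \<Omega>"
    and g: "g \<in> borel_measurable borel" "integrable lborel (\<lambda>z. \<bar>g z\<bar> powr p)"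
  shows "integrable lborel (\<lambda>z. \<psi> z * g z)"
proof -
  have "integrable lebesgue (\<lambda>z. \<bar>g z\<bar> powr p)"
    using g(2) integrable_completion[OF borel_measurable_integrable[OF g(2)]] by (simp only:)
  then have "integrable lebesgue (\<lambda>z. \<psi> z * g z)"
    using p_gt_1 by (intro integrable_test_function_mult[OF \<psi> borel_measurable_lebesgue[OF g(1)]]) auto
  moreover have *: "(\<lambda>z. \<psi> z * g z) \<in> borel_measurable lborel"
    using borel_measurable_times[OF borel_measurable_continuous_onI[OF test_functions_continuous[OF \<psi>]] g(1)]
    by simp
  ultimately show ?thesis using integrable_completion[OF *] by (simp only:)
qed

lemma integrable_v_partial:
  assumes \<psi>: "\<psi> \<in> test_functions \<Omega>" "b \<in> Basis"
  shows "integrable lborel (\<lambda>z. v z * partial_deriv b \<psi> z)"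
proof (rule integrable_continuous_support_compact[OF _ compact_cbox])
  show "continuous_on UNIV (\<lambda>z. v z * partial_deriv b \<psi> z)"
    by (intro continuous_on_mult continuous_on_v test_functions_continuous_partial[OF \<psi>])
  show "v z * partial_deriv b \<psi> z = 0" if "z \<notin> cbox (-2, -4) (2, 4)" for z
    using v_support(1)[OF that] by simp
qed

lemma test_function_slices:
  assumes "\<psi> \<in> test_functions \<Omega>"
  shows "continuous_on UNIV (\<lambda>x. v (x, y) * \<psi> (x, y))" "continuous_on UNIV (\<lambda>y. v (x, y) * \<psi> (x, y))"
proof -
  have "continuous_on UNIV (\<lambda>z. v z * \<psi> z)"
    by (intro continuous_on_mult continuous_on_v test_functions_continuous[OF assms])
  from continuous_on_compose2[OF this, of UNIV "\<lambda>x. (x, y)"]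
    continuous_on_compose2[OF this, of UNIV "\<lambda>y. (x, y)"]
  show "continuous_on UNIV (\<lambda>x. v (x, y) * \<psi> (x, y))" "continuous_on UNIV (\<lambda>y. v (x, y) * \<psi> (x, y))"
    by (simp_all add: continuous_on_Pair)
qed

text \<open>On each horizontal line, \<open>v \<psi>\<close> is differentiable everywhere, since \<open>\<psi>\<close> vanishes near \<open>K0\<close>.\<close>

lemma weak_deriv_fst:
  assumes \<psi>: "\<psi> \<in> test_functions (UNIV - K0)"
  shows "(LINT z|lborel. v z * partial_deriv (1, 0) \<psi> z) = - (LINT z|lborel. \<psi> z * vx z)"
proof -
  have b: "(1, 0) \<in> (Basis :: (real \<times> real) set)" by (simp add: Basis_prod_def)
  obtain R where R: "R > 0" "closure {z. \<psi> z \<noteq> 0} \<subseteq> ball 0 R"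
    using test_functions_bounded_support[OF \<psi>] by blast
  have int1: "integrable lborel (\<lambda>z. v z * partial_deriv (1, 0) \<psi> z)"
    by (rule integrable_v_partial[OF \<psi> b])
  have int2: "integrable lborel (\<lambda>z. \<psi> z * vx z)"
    by (rule integrable_mult_test_function[OF \<psi> borel_measurable_continuous_onI[OF continuous_on_vx] integrable_powr_vx])
  have "(LINT z|lborel. v z * partial_deriv (1, 0) \<psi> z + \<psi> z * vx z) = (LINT y::real|lborel. 0)"
  proof (rule integral_eq_integral_slices_fst)
    fix y
    show "((\<lambda>x. v (x, y) * partial_deriv (1, 0) \<psi> (x, y) + \<psi> (x, y) * vx (x, y)) has_integral 0) UNIV"
    proof (rule has_integral_zero_of_bounded_support[of "{}" "\<lambda>x. v (x, y) * \<psi> (x, y)" _ R])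
      fix x
      show "((\<lambda>x. v (x, y) * \<psi> (x, y)) has_field_derivative
          v (x, y) * partial_deriv (1, 0) \<psi> (x, y) + \<psi> (x, y) * vx (x, y)) (at x)"
      proof (cases "(x, y) \<in> closure {z. \<psi> z \<noteq> 0}")
        case True
        then have "(x, y) \<notin> K0" using \<psi> by (auto simp: test_functions_def)
        from DERIV_mult[OF DERIV_plateau[of x] DERIV_u_fst[OF this]]
        have "((\<lambda>x. v (x, y)) has_field_derivative vx (x, y)) (at x)"
          by (simp add: v_def vx_def)
        from DERIV_mult[OF this partial_deriv_fst[OF test_functions_differentiable[OF \<psi>]]]
        show ?thesis by (simp add: algebra_simps)
      next
        case False
        have "open ((\<lambda>x. (x, y)) -` (- closure {z. \<psi> z \<noteq> 0}))"
          by (intro open_vimage continuous_intros) auto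
        then have "((\<lambda>x. v (x, y) * \<psi> (x, y)) has_field_derivative 0) (at x)"
        proof (rule has_field_derivative_transform_within_open[OF DERIV_const[of 0]])
          fix x assume "x \<in> (\<lambda>x. (x, y)) -` (- closure {z. \<psi> z \<noteq> 0})"
          then have "\<psi> (x, y) = 0" by (intro test_functions_zero) simp
          then show "0 = v (x, y) * \<psi> (x, y)" by simp
        qed (use False in simp)
        then show ?thesis by (simp only: test_functions_zero[OF False]) simp
      qed
    next
      fix x assume "R \<le> \<bar>x\<bar>"
      then have "(x, y) \<notin> ball 0 R" using norm_fst_le[of x y] by (simp add: mem_ball_0)
      then have nin: "(x, y) \<notin> closure {z. \<psi> z \<noteq> 0}" using R by blast
      then show "v (x, y) * \<psi> (x, y) = 0"
        "v (x, y) * partial_deriv (1, 0) \<psi> (x, y) + \<psi> (x, y) * vx (x, y) = 0"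
        by (simp_all add: test_functions_zero[OF nin])
    qed (simp_all add: R test_function_slices[OF \<psi>])
  qed (simp_all add: int1 int2)
  then show ?thesis using int1 int2 by simp
qed

text \<open>Here the test function need not vanish near \<open>K0\<close>: each vertical line meets \<open>K0\<close> in at most one point,
  and this point is harmless because \<open>v\<close> is continuous.\<close>

lemma weak_deriv_snd:
  assumes \<psi>: "\<psi> \<in> test_functions UNIV"
  shows "(LINT z|lborel. v z * partial_deriv (0, 1) \<psi> z) = - (LINT z|lborel. \<psi> z * vy z)"
proof -
  have b: "(0, 1) \<in> (Basis :: (real \<times> real) set)" by (simp add: Basis_prod_def)
  obtain R where R: "R > 0" "closure {z. \<psi> z \<noteq> 0} \<subseteq> ball 0 R"
    using test_functions_bounded_support[OF \<psi>] by blast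
  have int1: "integrable lborel (\<lambda>z. v z * partial_deriv (0, 1) \<psi> z)"
    by (rule integrable_v_partial[OF \<psi> b])
  have int2: "integrable lborel (\<lambda>z. \<psi> z * vy z)"
    using integrable_powr_uy
    by (intro integrable_mult_test_function[OF \<psi> borel_measurable_vy]) (simp add: vy_def)
  have "(LINT z|lborel. v z * partial_deriv (0, 1) \<psi> z + \<psi> z * vy z) = (LINT x::real|lborel. 0)"
  proof (rule integral_eq_integral_slices_snd)
    fix x
    have "finite {y. (x, y) \<in> K0}"
    proof (cases "{y. (x, y) \<in> K0} = {}")
      case False
      then obtain y where "(x, y) \<in> K0" by auto
      then have "{y. (x, y) \<in> K0} \<subseteq> {y}" using K0_slice_unique by blast
      then show ?thesis by (rule finite_subset) simp
    qed simp
    then show "((\<lambda>y. v (x, y) * partial_deriv (0, 1) \<psi> (x, y) + \<psi> (x, y) * vy (x, y)) has_integral 0) UNIV"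
    proof (rule has_integral_zero_of_bounded_support[of _ "\<lambda>y. v (x, y) * \<psi> (x, y)" _ R])
      fix y assume "y \<notin> {y. (x, y) \<in> K0}"
      then have "(x, y) \<notin> K0" by simp
      from DERIV_cmult[OF DERIV_u_uy[OF this], of "plateau x"]
      have "((\<lambda>y. v (x, y)) has_field_derivative vy (x, y)) (at y)"
        by (simp add: v_def vy_def)
      from DERIV_mult[OF this partial_deriv_snd[OF test_functions_differentiable[OF \<psi>]]]
      show "((\<lambda>y. v (x, y) * \<psi> (x, y)) has_field_derivative
          v (x, y) * partial_deriv (0, 1) \<psi> (x, y) + \<psi> (x, y) * vy (x, y)) (at y)"
        by (simp add: algebra_simps)
    next
      fix y assume "R \<le> \<bar>y\<bar>"
      then have "(x, y) \<notin> ball 0 R" using norm_snd_le[of y x] by (simp add: mem_ball_0)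
      then have nin: "(x, y) \<notin> closure {z. \<psi> z \<noteq> 0}" using R by blast
      then show "v (x, y) * \<psi> (x, y) = 0"
        "v (x, y) * partial_deriv (0, 1) \<psi> (x, y) + \<psi> (x, y) * vy (x, y) = 0"
        by (simp_all add: test_functions_zero[OF nin])
    qed (simp_all add: R test_function_slices[OF \<psi>])
  qed (simp_all add: int1 int2)
  then show ?thesis using int1 int2 by simp
qed

lemma v_in_W1p_space:
  assumes "closed \<Gamma>" "\<Gamma> \<in> null_sets lborel" "K0 \<subseteq> \<Gamma>"
  shows "v \<in> W1p_space p (UNIV - \<Gamma>)"
proof -
  have \<Omega>: "UNIV - \<Gamma> \<in> sets borel" using assms(1) by (intro borel_open) (simp add: open_Diff)
  have bm: "v \<in> borel_measurable borel" "vx \<in> borel_measurable borel"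
    using continuous_on_v continuous_on_vx by (auto intro: borel_measurable_continuous_onI)
  have Lp: "v \<in> Lp_space p (UNIV - \<Gamma>)" "vx \<in> Lp_space p (UNIV - \<Gamma>)" "vy \<in> Lp_space p (UNIV - \<Gamma>)"
    using Lp_space_borel[OF bm(1) integrable_powr_v \<Omega>] Lp_space_borel[OF bm(2) integrable_powr_vx \<Omega>]
      Lp_space_borel[OF borel_measurable_vy _ \<Omega>] integrable_powr_uy by (simp_all add: vy_def)
  have eq1: "(LINT x|lebesgue_on (UNIV - \<Gamma>). v x * partial_deriv b \<psi> x) = (LINT x|lborel. v x * partial_deriv b \<psi> x)"
    if "\<psi> \<in> test_functions (UNIV - \<Gamma>)" "b \<in> Basis" for \<psi> b
    using borel_measurable_integrable[OF integrable_v_partial[OF that]]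
    by (intro integral_lebesgue_on_conull assms) simp
  have eq2: "(LINT x|lebesgue_on (UNIV - \<Gamma>). \<psi> x * g x) = (LINT x|lborel. \<psi> x * g x)"
    if "\<psi> \<in> test_functions (UNIV - \<Gamma>)" "g \<in> borel_measurable borel" for \<psi> g
    using test_functions_continuous[OF that(1)] that(2)
    by (intro integral_lebesgue_on_conull assms borel_measurable_times borel_measurable_continuous_onI[of \<psi>])
  have "weak_partial_deriv (UNIV - \<Gamma>) (1, 0) v vx"
    unfolding weak_partial_deriv_def
  proof
    fix \<psi> assume \<psi>: "\<psi> \<in> test_functions (UNIV - \<Gamma>)"
    then have "\<psi> \<in> test_functions (UNIV - K0)" using assms(3) by (auto intro: test_functions_mono)
    from weak_deriv_fst[OF this] eq1[OF \<psi>, of "(1, 0)"] eq2[OF \<psi> bm(2)]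
    show "(LINT x|lebesgue_on (UNIV - \<Gamma>). v x * partial_deriv (1, 0) \<psi> x)
        = - (LINT x|lebesgue_on (UNIV - \<Gamma>). \<psi> x * vx x)"
      by (simp add: Basis_prod_def)
  qed
  moreover have "weak_partial_deriv (UNIV - \<Gamma>) (0, 1) v vy"
    unfolding weak_partial_deriv_def
  proof
    fix \<psi> assume \<psi>: "\<psi> \<in> test_functions (UNIV - \<Gamma>)"
    then have "\<psi> \<in> test_functions UNIV" by (auto intro: test_functions_mono)
    from weak_deriv_snd[OF this] eq1[OF \<psi>, of "(0, 1)"] eq2[OF \<psi> borel_measurable_vy]
    show "(LINT x|lebesgue_on (UNIV - \<Gamma>). v x * partial_deriv (0, 1) \<psi> x)
        = - (LINT x|lebesgue_on (UNIV - \<Gamma>). \<psi> x * vy x)"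
      by (simp add: Basis_prod_def)
  qed
  ultimately show ?thesis
    using Lp by (auto simp: W1p_space_def Basis_prod_def)
qed

text \<open>The test function that detects the singular part of the derivative of \<open>v\<close> in \<open>x\<close>.\<close>

definition bump :: "real \<times> real \<Rightarrow> real" where
  "bump z = plateau (fst z) * plateau (snd z)"

lemma bump_test_function: "bump \<in> test_functions UNIV"
proof -
  have "times_cont_diff k bump" for k
    unfolding bump_def[abs_def]
    by (intro times_cont_diff_mult times_cont_diff_compose_fst times_cont_diff_compose_snd times_cont_diff_plateau)
  moreover have "closure {z. bump z \<noteq> 0} \<subseteq> cbox (-2, -2) (2, 2)"
  proof (rule closure_minimal)
    show "{z. bump z \<noteq> 0} \<subseteq> cbox (-2, -2) (2, 2)"
    proof
      fix z assume "z \<in> {z. bump z \<noteq> 0}"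
      then have "\<not> 2 \<le> \<bar>fst z\<bar>" "\<not> 2 \<le> \<bar>snd z\<bar>" by (auto simp: bump_def plateau_eq_0)
      then show "z \<in> cbox (-2, -2) (2, 2)" by (cases z) (auto simp: cbox_Pair_eq)
    qed
  qed (rule closed_cbox)
  then have "bounded (closure {z. bump z \<noteq> 0})" using bounded_cbox bounded_subset by blast
  ultimately show ?thesis by (auto simp: test_functions_def compact_eq_bounded_closed)
qed

lemma partial_deriv_bump: "partial_deriv (1, 0) bump (x, y) = partial_deriv 1 plateau x * plateau y"
proof (rule DERIV_unique)
  show "((\<lambda>x. bump (x, y)) has_field_derivative partial_deriv (1, 0) bump (x, y)) (at x)"
    by (rule partial_deriv_fst[OF test_functions_differentiable[OF bump_test_function]])
  show "((\<lambda>x. bump (x, y)) has_field_derivative partial_deriv 1 plateau x * plateau y) (at x)"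
    using DERIV_cmult_right[OF DERIV_plateau[of x], of "plateau y"] by (simp add: bump_def)
qed

lemma integral_plateau_square_pos: "0 < (LINT y|lborel. (plateau y)\<^sup>2)"
proof -
  have i: "integrable lborel (\<lambda>y. (plateau y)\<^sup>2)"
    by (rule integrable_continuous_support_compact[of _ "{-2..2}"])
      (auto intro!: continuous_on_power continuous_on_plateau plateau_eq_0 simp: abs_if)
  have "2 = (LINT y::real|lborel. indicator {-1..1} y :: real)" by simp
  also have "\<dots> \<le> (LINT y|lborel. (plateau y)\<^sup>2)"
  proof (rule integral_mono[OF _ i])
    show "integrable lborel (indicator {-1..1} :: real \<Rightarrow> real)" by (rule integrable_real_indicator) simp_all
    show "indicator {-1..1} y \<le> (plateau y)\<^sup>2" for y
    proof (cases "y \<in> {-1..1}")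
      case True
      then have "plateau y = 1" by (intro plateau_eq_1) auto
      then show ?thesis by simp
    qed simp
  qed
  finally show ?thesis by simp
qed

text \<open>If \<open>vx\<close> were the weak derivative of \<open>v\<close> on the plane, the left-hand side would be \<open>0\<close>. The
  integrand is \<open>u \<partial>\<^sub>x(plateau\<^sup>2) plateau\<close>. It vanishes for \<open>x \<le> 3 / 2\<close>, and to the right of this
  \<open>u (x, y) = plateau y\<close>.\<close>

lemma integral_bump_slices:
  "(LINT z|lborel. v z * partial_deriv (1, 0) bump z + bump z * vx z) = - (LINT y|lborel. (plateau y)\<^sup>2)"
proof -
  have b: "(1, 0) \<in> (Basis :: (real \<times> real) set)" by (simp add: Basis_prod_def)
  have "(LINT z|lborel. v z * partial_deriv (1, 0) bump z + bump z * vx z) = (LINT y|lborel. - (plateau y)\<^sup>2)"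
  proof (rule integral_eq_integral_slices_fst)
    show "integrable lborel (\<lambda>z. v z * partial_deriv (1, 0) bump z + bump z * vx z)"
      by (intro Bochner_Integration.integrable_add integrable_v_partial[OF bump_test_function b]
          integrable_mult_test_function[OF bump_test_function borel_measurable_continuous_onI[OF continuous_on_vx] integrable_powr_vx])
    have "(\<lambda>y. - (plateau y)\<^sup>2) \<in> borel_measurable borel"
      by (intro borel_measurable_continuous_onI continuous_on_minus continuous_on_power continuous_on_plateau)
    then show "(\<lambda>y. - (plateau y)\<^sup>2) \<in> borel_measurable lborel" by simp
  next
    fix y
    let ?H = "\<lambda>x. v (x, y) * partial_deriv (1, 0) bump (x, y) + bump (x, y) * vx (x, y)"
    have H: "?H x = 2 * plateau x * partial_deriv 1 plateau x * plateau y * u (x, y)" for x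
      by (simp add: partial_deriv_bump v_def vx_def bump_def algebra_simps)
    \<comment> \<open>The integrand vanishes for \<open>x \<le> 1\<close>, so this is a continuous antiderivative of it.\<close>
    define h where "h x = (plateau y)\<^sup>2 * (if x \<le> 1 then 0 else (plateau x)\<^sup>2 - 1)" for x
    have "(?H has_integral (h 2 - h (-2))) {-2..2}"
    proof (rule fundamental_theorem_of_calculus_strong[of "{1}"])
      show "continuous_on {-2..2} h"
        unfolding h_def[abs_def]
      proof (intro continuous_on_mult continuous_on_const)
        show "continuous_on {-2..2} (\<lambda>x. if x \<le> 1 then 0 else (plateau x)\<^sup>2 - 1)"
          by (rule continuous_on_cases_le[where h = "\<lambda>x. x" and a = 1])
            (auto intro!: continuous_intros continuous_on_plateau simp: plateau_eq_1)
      qed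
      fix x :: real assume x: "x \<in> {-2..2} - {1}"
      have "(h has_field_derivative ?H x) (at x)"
      proof (cases "x < 1")
        case True
        have "((\<lambda>x. 0) has_field_derivative 0) (at x)" by simp
        then have "(h has_field_derivative 0) (at x)"
          by (rule has_field_derivative_transform_within_open[where S = "{..<1}"])
            (use True in \<open>auto simp: h_def\<close>)
        moreover have "?H x = 0"
          unfolding H using True deriv_plateau_eq_0[of x] u_left[of "(x, y)"] by (cases "x \<le> 0") (auto simp: abs_if)
        ultimately show ?thesis by simp
      next
        case False
        then have x1: "1 < x" using x by auto
        have "((\<lambda>x. (plateau y)\<^sup>2 * ((plateau x)\<^sup>2 - 1)) has_field_derivative
            (plateau y)\<^sup>2 * (2 * plateau x * partial_deriv 1 plateau x)) (at x)"
          by (auto intro!: derivative_eq_intros DERIV_plateau)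
        then have "(h has_field_derivative (plateau y)\<^sup>2 * (2 * plateau x * partial_deriv 1 plateau x)) (at x)"
          by (rule has_field_derivative_transform_within_open[where S = "{1<..}"])
            (use x1 in \<open>auto simp: h_def\<close>)
        moreover have "?H x = (plateau y)\<^sup>2 * (2 * plateau x * partial_deriv 1 plateau x)"
          unfolding H using x1 u_right[of "(x, y)"] by (simp add: power2_eq_square)
        ultimately show ?thesis by simp
      qed
      then show "(h has_vector_derivative ?H x) (at x)"
        by (simp add: has_real_derivative_iff_has_vector_derivative)
    qed auto
    moreover have "h 2 - h (-2) = - (plateau y)\<^sup>2" by (simp add: h_def plateau_eq_0)
    ultimately have "(?H has_integral - (plateau y)\<^sup>2) {-2..2}" by simp
    then show "(?H has_integral - (plateau y)\<^sup>2) UNIV"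
    proof (rule has_integral_on_superset)
      fix x :: real assume "x \<notin> {-2..2}"
      then have "2 \<le> \<bar>x\<bar>" by auto
      then show "?H x = 0" unfolding H by (simp add: plateau_eq_0)
    qed simp
  qed
  then show ?thesis by simp
qed

text \<open>A weak derivative \<open>g\<close> on the plane agrees with \<open>vx\<close> when tested against \<open>bump\<close> times a cutoff. In
  the limit it agrees with \<open>vx\<close> when tested against \<open>bump\<close> itself, because \<open>K0\<close> is a null set.\<close>

lemma v_notin_W1p_space:
  assumes K0_null: "K0 \<in> null_sets lborel"
  shows "v \<notin> W1p_space p UNIV"
proof
  assume "v \<in> W1p_space p UNIV"
  then obtain g where g: "g \<in> Lp_space p UNIV" "weak_partial_deriv UNIV (1, 0) v g"
    by (auto simp: W1p_space_def Basis_prod_def)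
  have b: "(1, 0) \<in> (Basis :: (real \<times> real) set)" by (simp add: Basis_prod_def)
  have gm: "g \<in> borel_measurable lebesgue" "integrable lebesgue (\<lambda>z. \<bar>g z\<bar> powr p)"
    using g(1) by (simp_all add: Lp_space_def lebesgue_on_UNIV_eq)
  have weak: "(LINT z|lborel. v z * partial_deriv (1, 0) \<psi> z) = - (LINT z|lebesgue. \<psi> z * g z)"
    if "\<psi> \<in> test_functions UNIV" for \<psi>
  proof -
    have "(LINT z|lebesgue. v z * partial_deriv (1, 0) \<psi> z) = (LINT z|lborel. v z * partial_deriv (1, 0) \<psi> z)"
      using borel_measurable_integrable[OF integrable_v_partial[OF that b]] by (rule integral_completion)
    with g(2) that show ?thesis
      by (simp add: weak_partial_deriv_def integral_lebesgue_on_UNIV)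
  qed
  have vxm: "vx \<in> borel_measurable borel"
    using continuous_on_vx by (rule borel_measurable_continuous_onI)
  have bump_vx: "integrable lborel (\<lambda>z. bump z * vx z)"
    by (rule integrable_mult_test_function[OF bump_test_function vxm integrable_powr_vx])
  have bump_g: "integrable lebesgue (\<lambda>z. bump z * g z)"
    using p_gt_1 by (intro integrable_test_function_mult[OF bump_test_function gm]) simp
  define \<psi> where "\<psi> n z = bump z * cutoff n z" for n z
  have \<psi>: "\<psi> n \<in> test_functions (UNIV - K0)" for n
    unfolding \<psi>_def[abs_def]
    by (rule test_functions_mult_cutoff[OF bump_test_function times_cont_diff_cutoff open_cutoff_nbhd
          K0_subset_cutoff_nbhd cutoff_eq_0])
  have \<psi>_bound: "\<bar>\<psi> n z * f\<bar> \<le> \<bar>bump z * f\<bar>" for n z f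
    using mult_left_mono[OF cutoff_bounds(2)[of n z], of "\<bar>bump z * f\<bar>"] cutoff_bounds(1)[of n z]
    by (simp add: \<psi>_def abs_mult mult_ac)
  have \<psi>_lim: "(\<lambda>n. \<psi> n z * f) \<longlonglongrightarrow> bump z * f" if "z \<notin> K0" for z f
  proof -
    have "(\<lambda>n. bump z * cutoff n z * f) \<longlonglongrightarrow> bump z * 1 * f"
      by (intro tendsto_mult tendsto_const cutoff_tendsto that)
    then show ?thesis by (simp add: \<psi>_def)
  qed
  have \<psi>m: "\<psi> n \<in> borel_measurable borel" for n
    using test_functions_continuous[OF \<psi>] by (rule borel_measurable_continuous_onI)
  have "(\<lambda>n. LINT z|lebesgue. \<psi> n z * g z) \<longlonglongrightarrow> (LINT z|lebesgue. bump z * g z)"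
  proof (rule integral_dominated_convergence[where w = "\<lambda>z. \<bar>bump z * g z\<bar>"])
    show "AE z in lebesgue. (\<lambda>n. \<psi> n z * g z) \<longlonglongrightarrow> bump z * g z"
      using AE_not_in[OF null_sets_completionI[OF K0_null]] by eventually_elim (rule \<psi>_lim)
    show "AE z in lebesgue. norm (\<psi> n z * g z) \<le> \<bar>bump z * g z\<bar>" for n
      by (intro always_eventually allI) (simp only: real_norm_def \<psi>_bound)
    show "(\<lambda>z. \<psi> n z * g z) \<in> borel_measurable lebesgue" for n
      by (intro borel_measurable_times borel_measurable_lebesgue[OF \<psi>m] gm(1))
  qed (use bump_g in auto)
  moreover have "(\<lambda>n. LINT z|lborel. \<psi> n z * vx z) \<longlonglongrightarrow> (LINT z|lborel. bump z * vx z)"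
  proof (rule integral_dominated_convergence[where w = "\<lambda>z. \<bar>bump z * vx z\<bar>"])
    show "AE z in lborel. (\<lambda>n. \<psi> n z * vx z) \<longlonglongrightarrow> bump z * vx z"
      using AE_not_in[OF K0_null] by eventually_elim (rule \<psi>_lim)
    show "AE z in lborel. norm (\<psi> n z * vx z) \<le> \<bar>bump z * vx z\<bar>" for n
      by (intro always_eventually allI) (simp only: real_norm_def \<psi>_bound)
    show "(\<lambda>z. \<psi> n z * vx z) \<in> borel_measurable lborel" for n
      using borel_measurable_times[OF \<psi>m vxm] by simp
  qed (use bump_vx in auto)
  moreover have "(LINT z|lebesgue. \<psi> n z * g z) = (LINT z|lborel. \<psi> n z * vx z)" for n
    using weak[OF test_functions_mono[OF \<psi>]] weak_deriv_fst[OF \<psi>] by simp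
  ultimately have "(LINT z|lebesgue. bump z * g z) = (LINT z|lborel. bump z * vx z)"
    using LIMSEQ_unique by simp
  with weak[OF bump_test_function]
  have "(LINT z|lborel. v z * partial_deriv (1, 0) bump z) + (LINT z|lborel. bump z * vx z) = 0" by simp
  then have "(LINT z|lborel. v z * partial_deriv (1, 0) bump z + bump z * vx z) = 0"
    using bump_vx integrable_v_partial[OF bump_test_function b] by simp
  with integral_bump_slices integral_plateau_square_pos show False by simp
qed

lemma exists_nonremovable_holder_graph:
  "\<exists>\<Gamma>. holder_graph \<alpha> \<Gamma> \<and> \<not> W1p_removable_for_continuous p \<Gamma>"
proof -
  obtain f :: "real \<Rightarrow> real" and C where f: "\<And>x y. \<bar>f x - f y\<bar> \<le> C * \<bar>x - y\<bar> powr \<alpha>"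
    and sub: "K0 \<subseteq> {(x, f x) | x. x \<in> {0..1}}"
    using K0_subset_holder_graph by blast
  define \<Gamma> where "\<Gamma> = {(x, f x) | x. x \<in> {0..1}}"
  have closed: "closed \<Gamma>" unfolding \<Gamma>_def by (rule closed_continuous_graph[OF f \<alpha>_pos])
  have null: "\<Gamma> \<in> null_sets lborel"
    using closed unfolding \<Gamma>_def by (rule null_sets_continuous_graph)
  have K0: "K0 \<subseteq> \<Gamma>" using sub by (simp add: \<Gamma>_def)
  have "K0 \<in> null_sets lborel"
    using null_sets_subset[OF null _ K0] borel_closed[OF closed_K0] by simp
  then have "\<not> W1p_removable_for_continuous p \<Gamma>"
    using continuous_on_v v_in_W1p_space[OF closed null K0] v_notin_W1p_space
    by (auto simp: W1p_removable_for_continuous_def)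
  moreover have "holder_graph \<alpha> \<Gamma>"
    unfolding holder_graph_def using f \<Gamma>_def by blast
  ultimately show ?thesis by blast
qed

end

section \<open>Choice of the parameters\<close>

lemma sum_div_group:
  fixes f :: "nat \<Rightarrow> real"
  shows "(\<Sum>i<n * k. f (i div k)) = real k * (\<Sum>l<n. f l)"
proof -
  have "(\<Sum>i<n * k. f (i div k)) = (\<Sum>l<n. \<Sum>i=l * k..<l * k + k. f (i div k))"
    by (rule sum.nat_group[symmetric])
  also have "\<dots> = (\<Sum>l<n. \<Sum>i=l * k..<l * k + k. f l)"
  proof (intro sum.cong refl)
    fix l i assume "i \<in> {l * k..<l * k + k}"
    then have "i div k = l" by (intro div_nat_eqI) (auto simp: mult.commute)
    then show "f (i div k) = f l" by simp
  qed
  also have "\<dots> = real k * (\<Sum>l<n. f l)" by (simp add: sum_distrib_left)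
  finally show ?thesis .
qed

text \<open>The integer \<open>k\<close> is just above \<open>m powr (1 - 1 / p)\<close>, as the first inequality requires. The second
  one then holds for large \<open>m\<close>, because \<open>\<alpha> * (2 - 1 / p) < 1\<close>.\<close>

lemma exists_scales:
  fixes p \<alpha> :: real
  assumes p: "1 < p" and \<alpha>: "0 < \<alpha>" "\<alpha> < p / (2 * p - 1)"
  obtains m k :: nat where "5 \<le> m" "2 \<le> k" "(max 2 (real m / real k)) powr p < real m"
    "(4 * real ((4 * m + 1) * k)) powr \<alpha> \<le> real m"
proof -
  define \<theta> where "\<theta> = (p - 1) / p"
  have \<theta>: "0 < \<theta>" "(1 - \<theta>) * p = 1" "1 + \<theta> = (2 * p - 1) / p"
    using p by (simp_all add: \<theta>_def field_simps)
  define e where "e = 1 - \<alpha> * (1 + \<theta>)"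
  have e: "0 < e"
    using \<alpha>(2) p unfolding e_def \<theta>(3) by (simp add: field_simps)
  obtain m :: nat where m: "max (max 5 (2 powr p + 1)) ((40 powr \<alpha>) powr (1 / e)) \<le> real m"
    using real_arch_simple by blast
  then have m5: "5 \<le> real m" and mp: "2 powr p < real m" and me: "(40 powr \<alpha>) powr (1 / e) \<le> real m"
    by auto
  define x where "x = real m powr \<theta>"
  have x1: "1 \<le> x" unfolding x_def using m5 \<theta>(1) by (intro ge_one_powr_ge_zero) auto
  define k where "k = nat \<lfloor>x\<rfloor> + 1"
  have kx: "x < real k" "real k \<le> 2 * x" unfolding k_def using x1 by linarith+
  show ?thesis
  proof (rule that)
    show "5 \<le> m" using m5 by simp
    have "1 \<le> nat \<lfloor>x\<rfloor>" using x1 by linarith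
    then show "2 \<le> k" by (simp add: k_def)
    have "(real m / real k) powr p < real m"
    proof -
      have "real m / real k < real m / x"
        using kx x1 m5 by (intro divide_strict_left_mono) auto
      also have "real m / x = real m powr (1 - \<theta>)"
        using m5 by (simp add: x_def powr_diff)
      finally have "(real m / real k) powr p < (real m powr (1 - \<theta>)) powr p"
        using p by (intro powr_less_mono2) auto
      also have "\<dots> = real m" using m5 \<theta>(2) by (simp add: powr_powr)
      finally show ?thesis .
    qed
    with mp show "(max 2 (real m / real k)) powr p < real m" by (simp add: max_def)
    have "4 * real ((4 * m + 1) * k) \<le> 4 * ((5 * real m) * (2 * x))"
    proof -
      have "real ((4 * m + 1) * k) = (4 * real m + 1) * real k" by (simp add: algebra_simps)
      also have "\<dots> \<le> (5 * real m) * (2 * x)"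
        using m5 kx x1 by (intro mult_mono) auto
      finally show ?thesis by simp
    qed
    also have "\<dots> = 40 * real m powr (1 + \<theta>)"
      using m5 by (simp add: x_def powr_add)
    finally have "(4 * real ((4 * m + 1) * k)) powr \<alpha> \<le> (40 * real m powr (1 + \<theta>)) powr \<alpha>"
      using \<alpha> by (intro powr_mono2) auto
    also have "\<dots> = 40 powr \<alpha> * real m powr (\<alpha> * (1 + \<theta>))"
      by (simp add: powr_mult powr_powr mult.commute)
    also have "\<dots> \<le> real m powr e * real m powr (\<alpha> * (1 + \<theta>))"
    proof (rule mult_right_mono)
      have "((40 powr \<alpha>) powr (1 / e)) powr e \<le> real m powr e"
        using me e by (intro powr_mono2) auto
      then show "40 powr \<alpha> \<le> real m powr e" using e by (simp add: powr_powr)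
    qed simp
    also have "\<dots> = real m"
      using m5 by (simp add: powr_add[symmetric] e_def)
    finally show "(4 * real ((4 * m + 1) * k)) powr \<alpha> \<le> real m" .
  qed
qed

lemma exists_self_affine_function:
  fixes p \<alpha> :: real
  assumes p: "1 < p" and \<alpha>: "0 < \<alpha>" "\<alpha> < p / (2 * p - 1)"
  shows "\<exists>N a j w M c c' \<kappa> L \<gamma>. self_affine_function N a j w M \<alpha> c c' \<kappa> L \<gamma> p"
proof -
  obtain m k :: nat where m5: "5 \<le> m" and k2: "2 \<le> k"
    and \<gamma>: "(max 2 (real m / real k)) powr p < real m"
    and scale: "(4 * real ((4 * m + 1) * k)) powr \<alpha> \<le> real m"
    using exists_scales[OF assms] by blast
  \<comment> \<open>The offsets \<open>j i\<close> run through the integers from \<open>- 2 m\<close> to \<open>2 m\<close>, each taken by \<open>k\<close> columns.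
    The columns lie in \<open>[1/4, 3/4]\<close> and are separated by gaps of their own width.\<close>
  define N where "N = (4 * m + 1) * k"
  define w where "w = 1 / (4 * real N)"
  define a where "a i = 1 / 4 + real i / (2 * real N)" for i :: nat
  define j where "j i = real (i div k) - 2 * real m" for i :: nat
  define c where "c i y = (1 / real k) * (plateau y * smooth_hat (real m * y + - j i))" for i y
  have N_pos: "0 < real N" using k2 by (simp add: N_def add_pos_nonneg)
  have div_less: "i div k \<le> 4 * m" if "i < N" for i
    using less_mult_imp_div_less[of i "4 * m + 1" k] that by (simp add: N_def)
  have smooth_c: "times_cont_diff n (c i)" for n i
    unfolding c_def[abs_def]
    by (intro times_cont_diff_mult times_cont_diff_const times_cont_diff_plateau
        times_cont_diff_real_affine times_cont_diff_smooth_hat)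
  have c_zero: "c i y = 0" if "2 \<le> \<bar>y\<bar>" for i y
    using that by (simp add: c_def plateau_eq_0)
  have "\<exists>L. \<forall>y. \<bar>partial_deriv 1 (c i) y\<bar> \<le> L" for i
    using deriv_bounded_of_bounded_support[OF smooth_c c_zero] by blast
  then obtain Lc where Lc: "\<And>i y. \<bar>partial_deriv 1 (c i) y\<bar> \<le> Lc i" by metis
  obtain Lp where Lp: "\<And>y. \<bar>partial_deriv 1 plateau y\<bar> \<le> Lp"
    using deriv_bounded_of_bounded_support[OF times_cont_diff_plateau plateau_eq_0] by blast
  define L where "L = Lp + (\<Sum>i<N. Lc i)"
  have Lc0: "0 \<le> Lc i" for i using Lc[of i 0] by linarith
  have Lp0: "0 \<le> Lp" using Lp[of 0] by linarith
  have "self_affine_function N a j w (real m) \<alpha> c (\<lambda>i. partial_deriv 1 (c i)) (1 / real k) L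
      (max 2 (real m / real k)) p"
  proof unfold_locales
    show "0 < w" using N_pos by (simp add: w_def)
    show "2 * w \<le> \<bar>a i - a i'\<bar>" if "i < N" "i' < N" "i \<noteq> i'" for i i'
    proof -
      have "1 \<le> \<bar>real i - real i'\<bar>" using that(3) by linarith
      then have "1 / (2 * real N) \<le> \<bar>real i - real i'\<bar> / (2 * real N)"
        using N_pos by (intro divide_right_mono) auto
      also have "\<dots> = \<bar>a i - a i'\<bar>"
        using N_pos by (simp add: a_def diff_divide_distrib[symmetric])
      finally show ?thesis by (simp add: w_def)
    qed
    show "1 / 4 \<le> a i" if "i < N" for i by (simp add: a_def)
    show "a i + w \<le> 3 / 4" if "i < N" for i
    proof -
      have "real i + 1 \<le> real N" using that by linarith
      then show ?thesis using N_pos by (simp add: a_def w_def field_simps)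
    qed
    show "5 \<le> real m" using m5 by simp
    show "\<bar>j i\<bar> \<le> 2 * real m" if "i < N" for i
    proof -
      have "real (i div k) \<le> 4 * real m" using of_nat_mono[OF div_less[OF that], where 'a = real] by simp
      then show ?thesis by (simp add: j_def abs_le_iff)
    qed
    show "0 < \<alpha>" by fact
    show "\<alpha> \<le> 1"
    proof -
      have "p / (2 * p - 1) \<le> 1" using p by (simp add: divide_le_eq)
      with \<alpha>(2) show ?thesis by linarith
    qed
    show "1 \<le> real m * w powr \<alpha>"
    proof -
      have "w powr \<alpha> = 1 / (4 * real N) powr \<alpha>"
        unfolding w_def using N_pos by (simp add: powr_divide)
      moreover have "0 < (4 * real N) powr \<alpha>" using N_pos by simp
      ultimately show ?thesis using scale by (simp add: N_def le_divide_eq)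
    qed
    show "0 < 1 / real k" "1 / real k \<le> 1 / 2" using k2 by (simp_all add: divide_simps)
    show "(c i has_field_derivative partial_deriv 1 (c i) y) (at y)" for i y
      by (rule has_field_derivative_partial_deriv_1[OF smooth_c[of "Suc 0"]])
    show "\<bar>c i y\<bar> \<le> 1 / real k" for i y
    proof -
      have "\<bar>plateau y * smooth_hat (real m * y + - j i)\<bar> \<le> 1"
        unfolding abs_mult using plateau_bounds[of y] by (intro mult_le_one smooth_hat_bound) simp_all
      then show ?thesis using k2 by (simp add: c_def abs_mult divide_right_mono)
    qed
    show "\<bar>partial_deriv 1 (c i) y\<bar> \<le> L" if "i < N" for i y
    proof -
      have "Lc i \<le> (\<Sum>i<N. Lc i)" using that by (intro member_le_sum Lc0) auto
      then show ?thesis using Lc[of i y] Lp0 by (simp add: L_def)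
    qed
    show "\<bar>partial_deriv 1 plateau y\<bar> \<le> L" for y
      using Lp[of y] sum_nonneg[of "{..<N}" Lc] Lc0 by (simp add: L_def)
    show "c i y = 0" if "2 \<le> \<bar>y\<bar>" for i y using that by (rule c_zero)
    show "(\<Sum>i<N. c i y * plateau (real m * y - j i)) = plateau y" for y
    proof (cases "\<bar>y\<bar> \<le> 2")
      case True
      \<comment> \<open>Where a weight is nonzero, the profile of the corresponding copy is \<open>1\<close>.\<close>
      have hat: "smooth_hat t * plateau t = smooth_hat t" for t
        using smooth_hat_eq_0[of t] plateau_eq_1[of t] by (cases "1 \<le> \<bar>t\<bar>") simp_all
      define f where "f l = smooth_hat (real m * y - (real l - 2 * real m))" for l :: nat
      have "(\<Sum>i<N. c i y * plateau (real m * y - j i)) = (\<Sum>i<N. (plateau y / real k) * f (i div k))"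
      proof (intro sum.cong refl)
        fix i
        have "c i y * plateau (real m * y - j i)
            = (plateau y / real k) * (smooth_hat (real m * y - j i) * plateau (real m * y - j i))"
          by (simp add: c_def)
        also have "\<dots> = (plateau y / real k) * f (i div k)"
          unfolding hat f_def j_def ..
        finally show "c i y * plateau (real m * y - j i) = (plateau y / real k) * f (i div k)" .
      qed
      also have "\<dots> = (plateau y / real k) * (\<Sum>i<N. f (i div k))" by (simp only: sum_distrib_left)
      also have "(\<Sum>i<N. f (i div k)) = real k * (\<Sum>l<4 * m + 1. f l)"
        unfolding N_def by (rule sum_div_group)
      also have "(\<Sum>l<4 * m + 1. f l) = 1"
        unfolding f_def using True by (rule sum_smooth_hat)
      finally show ?thesis using k2 by simp
    next
      case False
      then show ?thesis by (simp add: c_def plateau_eq_0)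
    qed
    show "2 \<le> max 2 (real m / real k)" by simp
    show "real m * (1 / real k) \<le> max 2 (real m / real k)" by simp
  qed (use p \<gamma> in auto)
  then show ?thesis by blast
qed

theorem theorem4:
  shows "(\<forall>p \<alpha> :: real. 1 < p \<longrightarrow> 0 < \<alpha> \<longrightarrow> \<alpha> < p / (2 * p - 1) \<longrightarrow>
           (\<exists>\<Gamma>. holder_graph \<alpha> \<Gamma> \<and> \<not> W1p_removable_for_continuous p \<Gamma>)) \<and>
         (\<forall>\<alpha> :: real. 0 < \<alpha> \<longrightarrow> \<alpha> < 2 / 3 \<longrightarrow>
           (\<exists>\<Gamma>. holder_graph \<alpha> \<Gamma> \<and> \<not> W1p_removable_for_continuous 2 \<Gamma>))"
proof -
  have main: "\<exists>\<Gamma>. holder_graph \<alpha> \<Gamma> \<and> \<not> W1p_removable_for_continuous p \<Gamma>"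
    if "1 < p" "0 < \<alpha>" "\<alpha> < p / (2 * p - 1)" for p \<alpha> :: real
    using exists_self_affine_function[OF that] self_affine_function.exists_nonremovable_holder_graph
    by blast
  show ?thesis
    using main main[of 2] by simp
qed

end
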